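(* Let $\mathcal{X}$ and $\mathcal{Y}$ be metric spaces, $\mathcal{F}=\mathcal{B}(\mathcal{X})$ and $\mathcal{G}=\mathcal{B}(\mathcal{Y})$ their Borel $\sigma$-fields, $\mu$ a probability measure on $\mathcal{F}$ and $\nu$ a probability measure on $\mathcal{G}$. Let $c:\mathcal{X}\times\mathcal{Y}\rightarrow\mathbb{R}$ be a function such that $f_1+g_1\le c\le f_2+g_2$ everywhere on $\mathcal{X}\times\mathcal{Y}$ for some $f_1,f_2\in L_1(\mu)$ and $g_1,g_2\in L_1(\nu)$. Suppose that the map $x\mapsto c(x,y)$ is continuous for each $y\in\mathcal{Y}$ and the map $y\mapsto c(x,y)$ is $\mathcal{G}$-measurable for each $x\in\mathcal{X}$. Then: (i) $\alpha^*(c)=\beta^*(c)$ if $c$ is bounded below and $\mu$ is separable; (ii) $\alpha(c)=\beta(c)$ if $c$ is bounded above and $\mu$ is separable; (iii) $\alpha(c)=\beta(c)$ and $\alpha^*(c)=\beta^*(c)$ if $c$ is bounded and $\mu$ is separable; (iv) $\alpha(c)=\beta(c)$ and $\alpha^*(c)=\beta^*(c)$ if all the sections of $c$ (that is, all the maps $x\mapsto c(x,y)$ with $y\in\mathcal{Y}$ fixed and all the maps $y\mapsto c(x,y)$ with $x\in\mathcal{X}$ fixed) are continuous and at least one of $\mu$ and $\nu$ is separable.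
   Context: Let $\mathcal{H}=\mathcal{F}\otimes\mathcal{G}$ be the product $\sigma$-field on $\mathcal{X}\times\mathcal{Y}$ and $\Gamma(\mu,\nu)$ the set of ($\sigma$-additive) probability measures $P$ on $\mathcal{H}$ with marginals $\mu$ and $\nu$, i.e. $P(A\times\mathcal{Y})=\mu(A)$ and $P(\mathcal{X}\times B)=\nu(B)$ for all $A\in\mathcal{F}$, $B\in\mathcal{G}$. $L_1(\mu)$ is the class of $\mathcal{F}$-measurable, $\mu$-integrable functions $\mathcal{X}\to\mathbb{R}$ (real-valued, not identified when a.s. equal); similarly $L_1(\nu)$. Write $\mu(f)=\int f\,d\mu$, and similarly for other measures. For $f:\mathcal{X}\to\mathbb{R}$ and $g:\mathcal{Y}\to\mathbb{R}$, $f+g$ denotes the function $(x,y)\mapsto f(x)+g(y)$ on $\mathcal{X}\times\mathcal{Y}$. Let $L=\{f+g: f\in L_1(\mu),\ g\in L_1(\nu)\}$. A Borel probability measure on a metric space is separable if it gives measure $1$ to some separable Borel set. The function $c$ is not required to be $\mathcal{H}$-measurable. In each of the cases considered there are $A\in\mathcal{F}$, $B\in\mathcal{G}$ with $\mu(A)=\nu(B)=1$ such that $c\,1_{A\times B}$ is $\mathcal{H}$-measurable, so $c$ is measurable with respect to the completion $\overline{P}$ of each $P\in\Gamma(\mu,\nu)$, and one defines $$\alpha(c)=\inf_{P\in\Gamma(\mu,\nu)}\overline{P}(c),\qquad \alpha^*(c)=\sup_{P\in\Gamma(\mu,\nu)}\overline{P}(c),$$ $$\beta(c)=\sup\{\mu(f)+\nu(g):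 f+g\in L,\ f+g\le c\},\qquad \beta^*(c)=\inf\{\mu(f)+\nu(g): f+g\in L,\ f+g\ge c\},$$ where the inequalities hold everywhere on $\mathcal{X}\times\mathcal{Y}$. *)

theory Defs
  imports "HOL-Probability.Probability"
begin

definition couplings :: "'a measure \<Rightarrow> 'b measure \<Rightarrow> ('a \<times> 'b) measure set" where
  "couplings \<mu> \<nu> =
    {P. prob_space P \<and> sets P = sets (\<mu> \<Otimes>\<^sub>M \<nu>) \<and>
        (\<forall>A\<in>sets \<mu>. emeasure P (A \<times> space \<nu>) = emeasure \<mu> A) \<and>
        (\<forall>B\<in>sets \<nu>. emeasure P (space \<mu> \<times> B) = emeasure \<nu> B)}"

text \<open>The cost \<open>c\<close> need not be measurable for the product sigma-algebra, hence the integrals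
  with respect to completions. The Bochner integral of a non-integrable function is 0, and the
  real \<open>Inf\<close> and \<open>Sup\<close> are only meaningful for nonempty sets that are bounded on the relevant
  side. So the four values below are the intended ones only when \<open>c\<close> is measurable for the
  completion of every coupling and lies between two functions \<open>(x, y) \<mapsto> f x + g y\<close> with
  \<open>f\<close>, \<open>g\<close> integrable.\<close>

definition ot_primal_inf :: "'a measure \<Rightarrow> 'b measure \<Rightarrow> ('a \<times> 'b \<Rightarrow> real) \<Rightarrow> real" where
  "ot_primal_inf \<mu> \<nu> c = (INF P\<in>couplings \<mu> \<nu>. integral\<^sup>L (completion P) c)"

definition ot_primal_sup :: "'a measure \<Rightarrow> 'b measure \<Rightarrow> ('a \<times> 'b \<Rightarrow> real) \<Rightarrow> real" where
  "ot_primal_sup \<mu> \<nu> c = (SUP P\<in>couplings \<mu> \<nu>. integral\<^sup>L (completion P) c)"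

definition ot_dual_sup :: "'a measure \<Rightarrow> 'b measure \<Rightarrow> ('a \<times> 'b \<Rightarrow> real) \<Rightarrow> real" where
  "ot_dual_sup \<mu> \<nu> c =
    Sup {integral\<^sup>L \<mu> f + integral\<^sup>L \<nu> g | f g.
          integrable \<mu> f \<and> integrable \<nu> g \<and>
          (\<forall>x\<in>space \<mu>. \<forall>y\<in>space \<nu>. f x + g y \<le> c (x, y))}"

definition ot_dual_inf :: "'a measure \<Rightarrow> 'b measure \<Rightarrow> ('a \<times> 'b \<Rightarrow> real) \<Rightarrow> real" where
  "ot_dual_inf \<mu> \<nu> c =
    Inf {integral\<^sup>L \<mu> f + integral\<^sup>L \<nu> g | f g.
          integrable \<mu> f \<and> integrable \<nu> g \<and>
          (\<forall>x\<in>space \<mu>. \<forall>y\<in>space \<nu>. c (x, y) \<le> f x + g y)}"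

definition separable_measure :: "'a::metric_space measure \<Rightarrow> bool" where
  "separable_measure \<mu> \<longleftrightarrow>
    (\<exists>S\<in>sets borel. separable_space (top_of_set S) \<and> emeasure \<mu> S = 1)"

end

theory Submission
  imports Defs
begin

text \<open>
  Everything follows from \<open>\<beta>\<^sup>* \<le> \<alpha>\<^sup>*\<close>: weak duality gives the converse, \<open>c \<mapsto> - c\<close> exchanges the two
  problems, and \<open>(x, y) \<mapsto> (y, x)\<close> exchanges the two factors. The inequality is stable under
  perturbations of the cost that are small in the sense \<open>\<bar>c - c'\<bar> \<le> F + G\<close> with \<open>\<mu>(F) + \<nu>(G)\<close> small.
  It holds for costs \<open>h (a x) (b y)\<close> with finitely many values, where it is a finite transport problem,
  hence for bounded costs that are Lipschitz in \<open>x\<close> on a separable set. It is preserved by bounded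
  increasing limits: no compactness of couplings is available, but the dual potentials stay bounded,
  and dual near-optimizers of least \<open>L\<^sup>2\<close> norm converge almost everywhere. A bounded cost
  continuous in \<open>x\<close> is the increasing limit of its Lipschitz regularizations
  \<open>inf\<^sub>d c(d, y) + n d(x, d)\<close>, and truncation removes the boundedness.
\<close>

subsection \<open>Sublinear functionals and finite transport problems\<close>

text \<open>The spaces need not be complete nor the measures tight, so neither a maximizing coupling
  nor a weakly convergent sequence of couplings is at hand; limits are taken on the dual side only.
  This dictates the direction of approximation: when the costs increase, the sets of feasible dual
  pairs decrease, and a bound on the integrals of the limit cost holds for every approximant. The
  dual inequality is required at every point although the potentials converge only almost
  everywhere; on the exceptional null sets a large constant repairs it, since the potentials are
  bounded below. The asymmetry of the hypotheses enters in the discretization: off a set of small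
  measure, a cost Lipschitz in \<open>x\<close> is known up to a small error from its values at
  finitely many centres, so \<open>y\<close> matters only through the finite vector of rounded
  values there, and no topology on the second factor is used. Finally, \<open>c\<close> need not be
  jointly measurable; it is replaced by a measurable majorant that agrees with it over a set of full
  measure in the separable factor.\<close>

definition sublinear :: "(('a \<Rightarrow> real) \<Rightarrow> real) \<Rightarrow> bool" where
  "sublinear p \<longleftrightarrow>
    (\<forall>f g. p (\<lambda>x. f x + g x) \<le> p f + p g) \<and> (\<forall>f. \<forall>t\<ge>0. p (\<lambda>x. t * f x) = t * p f)"

lemma sublinear_add: "sublinear p \<Longrightarrow> p (\<lambda>x. f x + g x) \<le> p f + p g"
  by (simp add: sublinear_def)

lemma sublinear_scale: "sublinear p \<Longrightarrow> 0 \<le> t \<Longrightarrow> p (\<lambda>x. t * f x) = t * p f"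
  by (simp add: sublinear_def)

lemma sublinear_zero: "sublinear p \<Longrightarrow> p (\<lambda>x. 0) = 0"
  using sublinear_scale[of p 0 "\<lambda>x. 0"] by simp

lemma sublinear_uminus: "sublinear p \<Longrightarrow> 0 \<le> p f + p (\<lambda>x. - f x)"
  using sublinear_add[of p f "\<lambda>x. - f x"] by (simp add: sublinear_zero)

text \<open>Positive homogeneity follows from its inequality alone: the factor \<open>1 / t\<close>
  applied to \<open>t * f\<close> reverses it.\<close>

lemma sublinearI:
  assumes add: "\<And>f g. p (\<lambda>x. f x + g x) \<le> p f + p g"
    and zero: "p (\<lambda>x. 0) = 0"
    and scale: "\<And>f t. 0 < t \<Longrightarrow> p (\<lambda>x. t * f x) \<le> t * p f"
  shows "sublinear p"
proof -
  have "p (\<lambda>x. t * f x) = t * p f" if "0 \<le> t" for f t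
  proof (cases "t = 0")
    case False
    with that have t: "0 < t" by simp
    have "p (\<lambda>x. (1 / t) * (t * f x)) \<le> (1 / t) * p (\<lambda>x. t * f x)"
      using t by (intro scale) simp
    with t have "t * p f \<le> p (\<lambda>x. t * f x)" by (simp add: field_simps)
    with scale[OF t, of f] show ?thesis by simp
  qed (simp add: zero)
  with add show ?thesis by (simp add: sublinear_def)
qed

text \<open>The Hahn-Banach step. Only finitely many directions are needed for finite transport problems, so
  it is iterated without appeal to Zorn's lemma.\<close>

lemma sublinear_linearize_at:
  assumes p: "sublinear p"
  shows "\<exists>r. sublinear r \<and> (\<forall>f. r f \<le> p f) \<and> r (\<lambda>x. - h x) \<le> - p h"
proof -
  define P where "P f t = p (\<lambda>x. f x + t * h x) - t * p h" for f t
  \<comment> \<open>Here \<open>t = 0\<close> gives \<open>r \<le> p\<close>, and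
    \<open>t = 1\<close> at \<open>- h\<close> gives \<open>r (- h) \<le> - p h\<close>. Together
    with subadditivity this forces \<open>r h = p h\<close> and makes \<open>r\<close> odd in the
    direction \<open>h\<close>.\<close>
  define r where "r f = (INF t\<in>{0..}. P f t)" for f
  have bdd: "bdd_below (P f ` {0..})" for f
  proof (rule bdd_belowI2)
    fix t :: real assume "t \<in> {0..}"
    then have "t * p h = p (\<lambda>x. (f x + t * h x) + (- f x))"
      using sublinear_scale[OF p, of t h] by simp
    also have "\<dots> \<le> p (\<lambda>x. f x + t * h x) + p (\<lambda>x. - f x)"
      by (rule sublinear_add[OF p])
    finally show "- p (\<lambda>x. - f x) \<le> P f t" by (simp add: P_def)
  qed
  have r_le: "r f \<le> P f t" if "0 \<le> t" for f t
    unfolding r_def using that by (intro cINF_lower[OF bdd]) simp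
  have r_ge: "m \<le> r f" if "\<And>t. 0 \<le> t \<Longrightarrow> m \<le> P f t" for m f
    unfolding r_def using that by (intro cINF_greatest) auto
  have "sublinear r"
  proof (rule sublinearI)
    fix f g
    have *: "r (\<lambda>x. f x + g x) \<le> P f t + P g u" if "0 \<le> t" "0 \<le> u" for t u
    proof -
      have "r (\<lambda>x. f x + g x) \<le> P (\<lambda>x. f x + g x) (t + u)"
        using that by (intro r_le) simp
      also have "\<dots> \<le> P f t + P g u"
        using sublinear_add[OF p, of "\<lambda>x. f x + t * h x" "\<lambda>x. g x + u * h x"]
        by (simp add: P_def algebra_simps)
      finally show ?thesis .
    qed
    have "r (\<lambda>x. f x + g x) - P g u \<le> r f" if "0 \<le> u" for u
      using * that by (intro r_ge) (simp add: algebra_simps)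
    then have "r (\<lambda>x. f x + g x) - r f \<le> r g"
      by (intro r_ge) (simp add: algebra_simps)
    then show "r (\<lambda>x. f x + g x) \<le> r f + r g" by simp
  next
    show "r (\<lambda>x. 0) = 0"
      unfolding r_def by (simp add: P_def sublinear_scale[OF p] cong: INF_cong_simp)
  next
    fix f and t :: real assume t: "0 < t"
    have "r (\<lambda>x. t * f x) / t \<le> r f"
    proof (rule r_ge)
      fix u :: real assume u: "0 \<le> u"
      have "r (\<lambda>x. t * f x) \<le> P (\<lambda>x. t * f x) (t * u)"
        using t u by (intro r_le) simp
      also have "\<dots> = t * P f u"
        using sublinear_scale[OF p, of t "\<lambda>x. f x + u * h x"] t
        by (simp add: P_def algebra_simps)
      finally show "r (\<lambda>x. t * f x) / t \<le> P f u" using t by (simp add: field_simps)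
    qed
    with t show "r (\<lambda>x. t * f x) \<le> t * r f" by (simp add: field_simps)
  qed
  moreover have "r f \<le> p f" for f
    using r_le[of 0 f] by (simp add: P_def)
  moreover have "r (\<lambda>x. - h x) \<le> - p h"
    using r_le[of 1 "\<lambda>x. - h x"] by (simp add: P_def sublinear_zero[OF p])
  ultimately show ?thesis by blast
qed

text \<open>Oddness in a direction survives the passage to a smaller sublinear functional:
  \<open>r' (- k) \<le> - r k \<le> - r' k\<close>, and subadditivity gives the reverse. Hence later
  steps do not spoil earlier ones.\<close>

lemma sublinear_linearize_finite:
  assumes "finite Y" and "sublinear p"
  shows "\<exists>r. sublinear r \<and> (\<forall>f. r f \<le> p f) \<and> (\<forall>h\<in>Y. r (\<lambda>x. - h x) = - r h)"
  using assms
proof (induction Y)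
  case empty
  then show ?case by auto
next
  case (insert h Y)
  then obtain r where r: "sublinear r" "\<And>f. r f \<le> p f" "\<And>k. k \<in> Y \<Longrightarrow> r (\<lambda>x. - k x) = - r k"
    by blast
  obtain r' where r': "sublinear r'" "\<And>f. r' f \<le> r f" "r' (\<lambda>x. - h x) \<le> - r h"
    using sublinear_linearize_at[OF r(1), of h] by blast
  have "r' (\<lambda>x. - k x) = - r' k" if "k \<in> insert h Y" for k
  proof -
    have "r' (\<lambda>x. - k x) \<le> - r k"
      using that r(3)[of k] r'(2)[of "\<lambda>x. - k x"] r'(3) by auto
    then show ?thesis
      using r'(2)[of k] sublinear_uminus[OF r'(1), of k] by linarith
  qed
  moreover have "r' f \<le> p f" for f using r'(2)[of f] r(2)[of f] by simp
  ultimately show ?case using r'(1) by blast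
qed

lemma sublinear_linear_direction:
  assumes p: "sublinear p" and h: "p (\<lambda>x. - h x) = - p h"
  shows "p (\<lambda>x. a * h x + f x) = a * p h + p f"
proof -
  have pos: "p (\<lambda>x. a * k x + f x) = a * p k + p f"
    if a: "0 \<le> a" and k: "p (\<lambda>x. - k x) = - p k" for a k
  proof (rule antisym)
    show "p (\<lambda>x. a * k x + f x) \<le> a * p k + p f"
      using sublinear_add[OF p, of "\<lambda>x. a * k x" f] sublinear_scale[OF p a, of k] by simp
    show "a * p k + p f \<le> p (\<lambda>x. a * k x + f x)"
      using sublinear_add[OF p, of "\<lambda>x. a * k x + f x" "\<lambda>x. a * - k x"]
        sublinear_scale[OF p a, of "\<lambda>x. - k x"] k by simp
  qed
  show ?thesis
  proof (cases "0 \<le> a")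
    case False
    then have "p (\<lambda>x. (- a) * (- h x) + f x) = (- a) * p (\<lambda>x. - h x) + p f"
      using h by (intro pos) auto
    with h show ?thesis by simp
  qed (use pos h in auto)
qed

lemma sublinear_linear_sum:
  assumes "finite K" and p: "sublinear p"
    and "\<And>k. k \<in> K \<Longrightarrow> p (\<lambda>x. - e k x) = - p (e k)"
  shows "p (\<lambda>x. \<Sum>k\<in>K. a k * e k x) = (\<Sum>k\<in>K. a k * p (e k))"
  using assms(1,3)
proof (induction K)
  case empty
  then show ?case by (simp add: sublinear_zero[OF p])
next
  case (insert k K)
  have "p (\<lambda>x. a k * e k x + (\<Sum>k\<in>K. a k * e k x)) = a k * p (e k) + p (\<lambda>x. \<Sum>k\<in>K. a k * e k x)"
    using insert.prems by (intro sublinear_linear_direction[OF p]) simp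
  with insert show ?case by simp
qed

text \<open>The dual value \<open>Q\<close> is sublinear in the cost matrix. A minorant that is
  linear on the unit matrices and keeps the value of \<open>Q\<close> at the given cost is a
  transport plan, because the feasibility of explicit potentials encodes its sign and its marginals.
  Testing \<open>bound\<close> on this plan shows that the dual value is at most \<open>s\<close>;
  \<open>\<epsilon>\<close> pays for choosing potentials near the infimum.\<close>

lemma finite_transport_duality:
  fixes p :: "'i \<Rightarrow> real" and q :: "'j \<Rightarrow> real" and h :: "'i \<Rightarrow> 'j \<Rightarrow> real"
  assumes fin: "finite I" "finite J"
    and p: "\<And>i. i \<in> I \<Longrightarrow> 0 \<le> p i" "sum p I = 1"
    and q: "\<And>j. j \<in> J \<Longrightarrow> 0 \<le> q j" "sum q J = 1"
    and bound: "\<And>\<pi>. \<lbrakk>\<And>i j. i \<in> I \<Longrightarrow> j \<in> J \<Longrightarrow> 0 \<le> \<pi> i j;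
        \<And>i. i \<in> I \<Longrightarrow> (\<Sum>j\<in>J. \<pi> i j) = p i; \<And>j. j \<in> J \<Longrightarrow> (\<Sum>i\<in>I. \<pi> i j) = q j\<rbrakk>
        \<Longrightarrow> (\<Sum>i\<in>I. \<Sum>j\<in>J. \<pi> i j * h i j) \<le> s"
    and "0 < \<epsilon>"
  obtains u v where "\<And>i j. i \<in> I \<Longrightarrow> j \<in> J \<Longrightarrow> h i j \<le> u i + v j"
    and "(\<Sum>i\<in>I. p i * u i) + (\<Sum>j\<in>J. q j * v j) \<le> s + \<epsilon>"
proof -
  define cost where "cost = (\<lambda>(u, v). (\<Sum>i\<in>I. p i * u i) + (\<Sum>j\<in>J. q j * v j))"
  define D :: "('i \<times> 'j \<Rightarrow> real) \<Rightarrow> (('i \<Rightarrow> real) \<times> ('j \<Rightarrow> real)) set" where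
    "D \<phi> = {(u, v). \<forall>i\<in>I. \<forall>j\<in>J. \<phi> (i, j) \<le> u i + v j}" for \<phi>
  define Q where "Q \<phi> = (INF w\<in>D \<phi>. cost w)" for \<phi>
  \<comment> \<open>Summing the constraint against the product plan \<open>p i * q j\<close> bounds
    the dual values from below, so the infimum in \<open>Q\<close> is a genuine one.\<close>
  have lower: "(\<Sum>i\<in>I. \<Sum>j\<in>J. p i * q j * \<phi> (i, j)) \<le> cost w" if "w \<in> D \<phi>" for \<phi> w
  proof -
    obtain u v where w: "w = (u, v)" by (cases w)
    have "(\<Sum>i\<in>I. \<Sum>j\<in>J. p i * q j * \<phi> (i, j)) \<le> (\<Sum>i\<in>I. \<Sum>j\<in>J. p i * q j * (u i + v j))"
      using that p q by (intro sum_mono mult_left_mono) (auto simp: w D_def)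
    also have "\<dots> = (\<Sum>i\<in>I. \<Sum>j\<in>J. (p i * u i) * q j) + (\<Sum>i\<in>I. \<Sum>j\<in>J. p i * (q j * v j))"
      by (simp add: algebra_simps sum.distrib)
    also have "\<dots> = cost w"
      using p(2) q(2)
      by (simp add: w cost_def sum_distrib_left[symmetric] sum_distrib_right[symmetric])
    finally show ?thesis .
  qed
  have bdd: "bdd_below (cost ` D \<phi>)" for \<phi>
    using lower by (rule bdd_belowI2)
  have ne: "D \<phi> \<noteq> {}" for \<phi>
  proof -
    have "(\<lambda>i. \<Sum>j\<in>J. \<bar>\<phi> (i, j)\<bar>, \<lambda>j. 0) \<in> D \<phi>"
      unfolding D_def
    proof (clarsimp)
      fix i j assume "i \<in> I" "j \<in> J"
      have "\<phi> (i, j) \<le> \<bar>\<phi> (i, j)\<bar>" by simp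
      also have "\<dots> \<le> (\<Sum>j\<in>J. \<bar>\<phi> (i, j)\<bar>)"
        using fin \<open>j \<in> J\<close> by (intro member_le_sum) auto
      finally show "\<phi> (i, j) \<le> (\<Sum>j\<in>J. \<bar>\<phi> (i, j)\<bar>)" .
    qed
    then show ?thesis by blast
  qed
  have Q_le: "Q \<phi> \<le> cost w" if "w \<in> D \<phi>" for \<phi> w
    unfolding Q_def using that by (intro cINF_lower[OF bdd])
  have Q_ge: "m \<le> Q \<phi>" if "\<And>w. w \<in> D \<phi> \<Longrightarrow> m \<le> cost w" for m \<phi>
    unfolding Q_def using that ne by (intro cINF_greatest) auto
  have Q: "sublinear Q"
  proof (rule sublinearI)
    fix \<phi> \<psi>
    have *: "Q (\<lambda>x. \<phi> x + \<psi> x) \<le> cost w + cost w'" if "w \<in> D \<phi>" "w' \<in> D \<psi>" for w w'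
    proof -
      obtain u v u' v' where w: "w = (u, v)" "w' = (u', v')" by (cases w, cases w') auto
      have "(\<lambda>i. u i + u' i, \<lambda>j. v j + v' j) \<in> D (\<lambda>x. \<phi> x + \<psi> x)"
        using that by (force simp: D_def w intro: order_trans[OF add_mono])
      from Q_le[OF this] show ?thesis
        by (simp add: cost_def w sum.distrib algebra_simps)
    qed
    have "Q (\<lambda>x. \<phi> x + \<psi> x) - cost w \<le> Q \<psi>" if "w \<in> D \<phi>" for w
      using *[OF that] by (intro Q_ge) (simp add: algebra_simps)
    then have "Q (\<lambda>x. \<phi> x + \<psi> x) - Q \<psi> \<le> Q \<phi>"
      by (intro Q_ge) (simp add: algebra_simps)
    then show "Q (\<lambda>x. \<phi> x + \<psi> x) \<le> Q \<phi> + Q \<psi>" by simp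
  next
    show "Q (\<lambda>x. 0) = 0"
    proof (rule antisym)
      have "(\<lambda>i. 0, \<lambda>j. 0) \<in> D (\<lambda>x. 0)" by (simp add: D_def)
      from Q_le[OF this] show "Q (\<lambda>x. 0) \<le> 0" by (simp add: cost_def)
      show "0 \<le> Q (\<lambda>x. 0)" using lower[of _ "\<lambda>x. 0"] by (intro Q_ge) simp
    qed
  next
    fix \<phi> and t :: real assume t: "0 < t"
    have "Q (\<lambda>x. t * \<phi> x) / t \<le> Q \<phi>"
    proof (rule Q_ge)
      fix w assume "w \<in> D \<phi>"
      moreover obtain u v where w: "w = (u, v)" by (cases w)
      ultimately have "(\<lambda>i. t * u i, \<lambda>j. t * v j) \<in> D (\<lambda>x. t * \<phi> x)"
        using t by (simp add: D_def distrib_left[symmetric])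
      from Q_le[OF this] have "Q (\<lambda>x. t * \<phi> x) \<le> t * cost w"
        by (simp add: cost_def w algebra_simps sum_distrib_left)
      with t show "Q (\<lambda>x. t * \<phi> x) / t \<le> cost w" by (simp add: field_simps)
    qed
    with t show "Q (\<lambda>x. t * \<phi> x) \<le> t * Q \<phi>" by (simp add: field_simps)
  qed
  define e :: "'i \<times> 'j \<Rightarrow> 'i \<times> 'j \<Rightarrow> real" where "e k x = (if x = k then 1 else 0)" for k x
  define K where "K = I \<times> J"
  have K: "finite K" using fin by (simp add: K_def)
  \<comment> \<open>This is \<open>h\<close> extended by zero outside \<open>K\<close>, expanded in
    unit matrices so that a functional linear on those can be evaluated at it.\<close>
  define h' where "h' x = (\<Sum>k\<in>K. case_prod h k * e k x)" for x
  \<comment> \<open>The first linearization pins the value at \<open>h'\<close>. All later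
    functionals lie below \<open>r0\<close> and so keep
    \<open>r (- h') \<le> - Q h'\<close>.\<close>
  obtain r0 where r0: "sublinear r0" "\<And>\<phi>. r0 \<phi> \<le> Q \<phi>" "r0 (\<lambda>x. - h' x) \<le> - Q h'"
    using sublinear_linearize_at[OF Q, of h'] by blast
  obtain r where r: "sublinear r" "\<And>\<phi>. r \<phi> \<le> r0 \<phi>"
    and re: "\<And>k. k \<in> K \<Longrightarrow> r (\<lambda>x. - e k x) = - r (e k)"
    using sublinear_linearize_finite[OF _ r0(1), of "e ` K"] K by blast
  have r_sum: "r (\<lambda>x. \<Sum>k\<in>K. a k * e k x) = (\<Sum>k\<in>K. a k * r (e k))" for a
    using K r(1) re by (rule sublinear_linear_sum)
  have r_le: "r \<phi> \<le> cost w" if "w \<in> D \<phi>" for \<phi> w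
    using r(2)[of \<phi>] r0(2)[of \<phi>] Q_le[OF that] by linarith
  have sum_e: "(\<Sum>k\<in>K. a k * e k x) = (if x \<in> K then a x else 0)" for a x
    using K by (simp add: e_def if_distrib cong: if_cong)
  \<comment> \<open>Zero potentials are feasible for the cost \<open>- e k\<close>, hence
    \<open>r (- e k) \<le> 0\<close>.\<close>
  have pi_nonneg: "0 \<le> r (e k)" if "k \<in> K" for k
  proof -
    have "(\<lambda>i. 0, \<lambda>j. 0) \<in> D (\<lambda>x. - e k x)" by (simp add: D_def e_def)
    from r_le[OF this] re[OF that] show ?thesis by (simp add: cost_def)
  qed
  \<comment> \<open>The pair \<open>(a, b)\<close> is feasible for its own sum, which gives one
    inequality; the negated pair gives the other. Indicator functions inserted for \<open>a\<close>
    or \<open>b\<close> then yield the marginals.\<close>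
  have pi_sum: "(\<Sum>k\<in>K. (a (fst k) + b (snd k)) * r (e k)) = cost (a, b)" for a b
  proof -
    have le: "(\<Sum>k\<in>K. (a (fst k) + b (snd k)) * r (e k)) \<le> cost (a, b)" for a b
    proof -
      have "(a, b) \<in> D (\<lambda>x. \<Sum>k\<in>K. (a (fst k) + b (snd k)) * e k x)"
        unfolding D_def sum_e by (auto simp: K_def)
      from r_le[OF this] show ?thesis by (simp only: r_sum)
    qed
    show ?thesis
      using le[of a b] le[of "\<lambda>i. - a i" "\<lambda>j. - b j"]
      by (simp add: cost_def sum_negf algebra_simps sum.distrib sum_subtractf)
  qed
  define \<pi> where "\<pi> i j = r (e (i, j))" for i j
  have pi_sum': "(\<Sum>i\<in>I. \<Sum>j\<in>J. (a i + b j) * \<pi> i j) = cost (a, b)" for a b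
    by (simp add: pi_sum[symmetric] K_def sum.cartesian_product \<pi>_def case_prod_beta)
  have "(\<Sum>i\<in>I. \<Sum>j\<in>J. \<pi> i j * h i j) \<le> s"
  proof (rule bound)
    show "0 \<le> \<pi> i j" if "i \<in> I" "j \<in> J" for i j
      using pi_nonneg that by (simp add: \<pi>_def K_def)
    show "(\<Sum>j\<in>J. \<pi> i j) = p i" if i: "i \<in> I" for i
    proof -
      have "(\<Sum>i'\<in>I. \<Sum>j\<in>J. ((if i' = i then 1 else 0) + 0) * \<pi> i' j)
          = (\<Sum>i'\<in>I. if i' = i then \<Sum>j\<in>J. \<pi> i' j else 0)"
        by (intro sum.cong) auto
      moreover have "cost (\<lambda>i'. if i' = i then 1 else 0, \<lambda>j. 0)
          = (\<Sum>i'\<in>I. if i' = i then p i' else 0)"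
        by (auto simp: cost_def intro!: sum.cong)
      ultimately show ?thesis
        using pi_sum'[of "\<lambda>i'. if i' = i then 1 else 0" "\<lambda>j. 0"] fin i by simp
    qed
    show "(\<Sum>i\<in>I. \<pi> i j) = q j" if j: "j \<in> J" for j
    proof -
      have "(\<Sum>i\<in>I. \<Sum>j'\<in>J. (0 + (if j' = j then 1 else 0)) * \<pi> i j')
          = (\<Sum>i\<in>I. \<Sum>j'\<in>J. if j' = j then \<pi> i j' else 0)"
        by (intro sum.cong) auto
      moreover have "cost (\<lambda>i. 0, \<lambda>j'. if j' = j then 1 else 0)
          = (\<Sum>j'\<in>J. if j' = j then q j' else 0)"
        by (auto simp: cost_def intro!: sum.cong)
      ultimately show ?thesis
        using pi_sum'[of "\<lambda>i. 0" "\<lambda>j'. if j' = j then 1 else 0"] fin j by simp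
    qed
  qed
  also have "(\<Sum>i\<in>I. \<Sum>j\<in>J. \<pi> i j * h i j) = (\<Sum>k\<in>K. case_prod h k * r (e k))"
    by (simp add: K_def sum.cartesian_product \<pi>_def case_prod_beta mult.commute)
  finally have rh: "(\<Sum>k\<in>K. case_prod h k * r (e k)) \<le> s" .
  have "r (\<lambda>x. - h' x) = (\<Sum>k\<in>K. (- case_prod h k) * r (e k))"
    using r_sum[of "\<lambda>k. - case_prod h k"] by (simp add: h'_def sum_negf)
  then have "Q h' \<le> s"
    using rh r(2)[of "\<lambda>x. - h' x"] r0(3) by (simp add: sum_negf)
  with \<open>0 < \<epsilon>\<close> have "Q h' < s + \<epsilon>" by simp
  then obtain w where w: "w \<in> D h'" "cost w < s + \<epsilon>"
    using cINF_less_iff[OF ne bdd] unfolding Q_def by blast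
  obtain u v where uv: "w = (u, v)" by (cases w)
  show thesis
  proof (rule that)
    show "h i j \<le> u i + v j" if "i \<in> I" "j \<in> J" for i j
      using w(1) that unfolding uv D_def h'_def sum_e by (auto simp: K_def)
    show "(\<Sum>i\<in>I. p i * u i) + (\<Sum>j\<in>J. q j * v j) \<le> s + \<epsilon>"
      using w(2) by (simp add: uv cost_def)
  qed
qed

subsection \<open>Couplings\<close>

lemma couplingsD:
  assumes "P \<in> couplings M N"
  shows "prob_space P" "sets P = sets (M \<Otimes>\<^sub>M N)" "space P = space M \<times> space N"
    and "distr P M fst = M" "distr P N snd = N"
    and "fst \<in> P \<rightarrow>\<^sub>M M" "snd \<in> P \<rightarrow>\<^sub>M N"
proof -
  show "prob_space P" and s: "sets P = sets (M \<Otimes>\<^sub>M N)"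
    using assms by (auto simp: couplings_def)
  from sets_eq_imp_space_eq[OF s] show sp: "space P = space M \<times> space N"
    by (simp add: space_pair_measure)
  show m: "fst \<in> P \<rightarrow>\<^sub>M M" "snd \<in> P \<rightarrow>\<^sub>M N"
    by (simp_all add: measurable_cong_sets[OF s refl])
  show "distr P M fst = M"
  proof (rule measure_eqI)
    fix A assume A: "A \<in> sets (distr P M fst)"
    then have "fst -` A \<inter> space P = A \<times> space N"
      using sets.sets_into_space by (fastforce simp: sp)
    with A m assms show "emeasure (distr P M fst) A = emeasure M A"
      by (simp add: emeasure_distr couplings_def)
  qed simp
  show "distr P N snd = N"
  proof (rule measure_eqI)
    fix A assume A: "A \<in> sets (distr P N snd)"
    then have "snd -` A \<inter> space P = space M \<times> A"
      using sets.sets_into_space by (fastforce simp: sp)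
    with A m assms show "emeasure (distr P N snd) A = emeasure N A"
      by (simp add: emeasure_distr couplings_def)
  qed simp
qed

lemma coupling_fst:
  fixes f :: "'a \<Rightarrow> real"
  assumes "P \<in> couplings M N" and f: "integrable M f"
  shows "integrable P (\<lambda>z. f (fst z))" "(\<integral>z. f (fst z) \<partial>P) = integral\<^sup>L M f"
proof -
  note P = couplingsD[OF assms(1)]
  show "integrable P (\<lambda>z. f (fst z))"
    using integrable_distr[OF P(6)] f by (simp add: P(4))
  show "(\<integral>z. f (fst z) \<partial>P) = integral\<^sup>L M f"
    using integral_distr[OF P(6) borel_measurable_integrable[OF f]] by (simp add: P(4))
qed

lemma coupling_snd:
  fixes g :: "'b \<Rightarrow> real"
  assumes "P \<in> couplings M N" and g: "integrable N g"
  shows "integrable P (\<lambda>z. g (snd z))" "(\<integral>z. g (snd z) \<partial>P) = integral\<^sup>L N g"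
proof -
  note P = couplingsD[OF assms(1)]
  show "integrable P (\<lambda>z. g (snd z))"
    using integrable_distr[OF P(7)] g by (simp add: P(5))
  show "(\<integral>z. g (snd z) \<partial>P) = integral\<^sup>L N g"
    using integral_distr[OF P(7) borel_measurable_integrable[OF g]] by (simp add: P(5))
qed

text \<open>The bound involves the marginals only, so it gives integrability under all couplings at
  once.\<close>

definition sum_dominated :: "'a measure \<Rightarrow> 'b measure \<Rightarrow> ('a \<times> 'b \<Rightarrow> real) \<Rightarrow> bool" where
  "sum_dominated M N c \<longleftrightarrow> c \<in> borel_measurable (M \<Otimes>\<^sub>M N) \<and>
    (\<exists>F G. integrable M F \<and> integrable N G \<and>
      (\<forall>x\<in>space M. \<forall>y\<in>space N. \<bar>c (x, y)\<bar> \<le> F x + G y))"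

lemma sum_dominated_measurable: "sum_dominated M N c \<Longrightarrow> c \<in> borel_measurable (M \<Otimes>\<^sub>M N)"
  by (simp add: sum_dominated_def)

lemma integrable_coupling:
  assumes P: "P \<in> couplings M N" and c: "sum_dominated M N c"
  shows "integrable P c"
proof -
  obtain F G where FG: "integrable M F" "integrable N G"
    "\<And>x y. x \<in> space M \<Longrightarrow> y \<in> space N \<Longrightarrow> \<bar>c (x, y)\<bar> \<le> F x + G y"
    using c by (auto simp: sum_dominated_def)
  note D = couplingsD[OF P]
  have "integrable P (\<lambda>z. F (fst z) + G (snd z))"
    using coupling_fst(1)[OF P FG(1)] coupling_snd(1)[OF P FG(2)] by simp
  moreover have "c \<in> borel_measurable P"
    using sum_dominated_measurable[OF c] by (simp add: measurable_cong_sets[OF D(2) refl])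
  moreover have "AE z in P. norm (c z) \<le> norm (F (fst z) + G (snd z))"
    using FG(3) by (intro AE_I2) (force simp: D(3))
  ultimately show ?thesis by (rule Bochner_Integration.integrable_bound)
qed

text \<open>Weak duality. The almost sure form serves costs that agree with \<open>c\<close> only
  almost surely under each coupling.\<close>

lemma coupling_integral_le:
  fixes c :: "'a \<times> 'b \<Rightarrow> real"
  assumes P: "P \<in> couplings M N" and c: "integrable P c"
    and f: "integrable M f" and g: "integrable N g"
    and le: "AE z in P. c z \<le> f (fst z) + g (snd z)"
  shows "integral\<^sup>L P c \<le> integral\<^sup>L M f + integral\<^sup>L N g"
proof -
  have "integral\<^sup>L P c \<le> (\<integral>z. f (fst z) + g (snd z) \<partial>P)"
    using c coupling_fst(1)[OF P f] coupling_snd(1)[OF P g] le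
    by (intro integral_mono_AE) auto
  also have "\<dots> = integral\<^sup>L M f + integral\<^sup>L N g"
    using coupling_fst[OF P f] coupling_snd[OF P g] by simp
  finally show ?thesis .
qed

lemma coupling_swap:
  assumes P: "P \<in> couplings N M"
  shows "distr P (M \<Otimes>\<^sub>M N) prod.swap \<in> couplings M N"
proof -
  note D = couplingsD[OF P]
  have m: "prod.swap \<in> P \<rightarrow>\<^sub>M M \<Otimes>\<^sub>M N"
    unfolding prod.swap_def by (intro measurable_Pair D)
  have "emeasure P (prod.swap -` (A \<times> space N) \<inter> space P) = emeasure M A" if "A \<in> sets M" for A
  proof -
    have "prod.swap -` (A \<times> space N) \<inter> space P = space N \<times> A"
      using sets.sets_into_space[OF that] by (auto simp: D(3))
    then show ?thesis using P that by (simp add: couplings_def)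
  qed
  moreover have "emeasure P (prod.swap -` (space M \<times> B) \<inter> space P) = emeasure N B"
    if "B \<in> sets N" for B
  proof -
    have "prod.swap -` (space M \<times> B) \<inter> space P = B \<times> space M"
      using sets.sets_into_space[OF that] by (auto simp: D(3))
    then show ?thesis using P that by (simp add: couplings_def)
  qed
  ultimately show ?thesis
    using prob_space.prob_space_distr[OF D(1) m]
    by (simp add: couplings_def emeasure_distr[OF m])
qed

text \<open>The inequality \<open>\<beta>\<^sup>* \<le> \<alpha>\<^sup>*\<close>, in a form that makes no use of suprema and infima.\<close>

definition sup_duality :: "'a measure \<Rightarrow> 'b measure \<Rightarrow> ('a \<times> 'b \<Rightarrow> real) \<Rightarrow> bool" where
  "sup_duality M N c \<longleftrightarrow>
    (\<forall>s \<epsilon>. (\<forall>P\<in>couplings M N. integral\<^sup>L P c \<le> s) \<longrightarrow> 0 < \<epsilon> \<longrightarrow>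
      (\<exists>f g. integrable M f \<and> integrable N g \<and>
        (\<forall>x\<in>space M. \<forall>y\<in>space N. c (x, y) \<le> f x + g y) \<and>
        integral\<^sup>L M f + integral\<^sup>L N g \<le> s + \<epsilon>))"

lemma sup_dualityI:
  assumes "\<And>s \<epsilon>. (\<And>P. P \<in> couplings M N \<Longrightarrow> integral\<^sup>L P c \<le> s) \<Longrightarrow> 0 < \<epsilon> \<Longrightarrow>
      \<exists>f g. integrable M f \<and> integrable N g \<and>
        (\<forall>x\<in>space M. \<forall>y\<in>space N. c (x, y) \<le> f x + g y) \<and>
        integral\<^sup>L M f + integral\<^sup>L N g \<le> s + \<epsilon>"
  shows "sup_duality M N c"
  unfolding sup_duality_def by (intro allI impI assms) (rule bspec)

lemma sup_dualityE:
  assumes "sup_duality M N c" and "\<And>P. P \<in> couplings M N \<Longrightarrow> integral\<^sup>L P c \<le> s" and "0 < \<epsilon>"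
  obtains f g where "integrable M f" "integrable N g"
    "\<And>x y. x \<in> space M \<Longrightarrow> y \<in> space N \<Longrightarrow> c (x, y) \<le> f x + g y"
    "integral\<^sup>L M f + integral\<^sup>L N g \<le> s + \<epsilon>"
  using assms(1)[unfolded sup_duality_def, rule_format, OF assms(2,3)] that by blast

lemma sup_duality_swap:
  assumes c: "c \<in> borel_measurable (M \<Otimes>\<^sub>M N)" and d: "sup_duality N M (\<lambda>z. c (prod.swap z))"
  shows "sup_duality M N c"
proof (rule sup_dualityI)
  fix s \<epsilon> :: real
  assume s: "\<And>P. P \<in> couplings M N \<Longrightarrow> integral\<^sup>L P c \<le> s" and \<epsilon>: "0 < \<epsilon>"
  have "(\<integral>z. c (prod.swap z) \<partial>P) \<le> s" if P: "P \<in> couplings N M" for P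
  proof -
    have "prod.swap \<in> P \<rightarrow>\<^sub>M M \<Otimes>\<^sub>M N"
      unfolding prod.swap_def by (intro measurable_Pair couplingsD[OF P])
    from integral_distr[OF this c] s[OF coupling_swap[OF P]] show ?thesis by simp
  qed
  from sup_dualityE[OF d this \<epsilon>] obtain g f where "integrable N g" "integrable M f"
    "\<And>y x. y \<in> space N \<Longrightarrow> x \<in> space M \<Longrightarrow> c (prod.swap (y, x)) \<le> g y + f x"
    "integral\<^sup>L N g + integral\<^sup>L M f \<le> s + \<epsilon>" by blast
  then show "\<exists>f g. integrable M f \<and> integrable N g \<and>
      (\<forall>x\<in>space M. \<forall>y\<in>space N. c (x, y) \<le> f x + g y) \<and>
      integral\<^sup>L M f + integral\<^sup>L N g \<le> s + \<epsilon>"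
    by (intro exI[of _ f] exI[of _ g]) (simp add: add.commute)
qed

text \<open>An error of the form \<open>F x + G y\<close> has the same small integral under every
  coupling, so it hardly changes the primal bound. It can also be added to the potentials, which
  preserves the dual inequality at every point.\<close>

lemma sup_duality_approx:
  assumes c: "sum_dominated M N c"
    and approx: "\<And>\<delta>::real. 0 < \<delta> \<Longrightarrow> \<exists>c' F G. sum_dominated M N c' \<and> sup_duality M N c' \<and>
      integrable M F \<and> integrable N G \<and> integral\<^sup>L M F + integral\<^sup>L N G \<le> \<delta> \<and>
      (\<forall>x\<in>space M. \<forall>y\<in>space N. \<bar>c (x, y) - c' (x, y)\<bar> \<le> F x + G y)"
  shows "sup_duality M N c"
proof (rule sup_dualityI)
  fix s \<epsilon> :: real
  assume s: "\<And>P. P \<in> couplings M N \<Longrightarrow> integral\<^sup>L P c \<le> s" and \<epsilon>: "0 < \<epsilon>"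
  \<comment> \<open>One third each for the change of the primal bound, the slack of the dual pair
    for \<open>c'\<close>, and the enlargement of that pair by \<open>F\<close> and
    \<open>G\<close>.\<close>
  obtain c' F G where c': "sum_dominated M N c'" "sup_duality M N c'"
    and FG: "integrable M F" "integrable N G" "integral\<^sup>L M F + integral\<^sup>L N G \<le> \<epsilon> / 3"
    and close: "\<And>x y. x \<in> space M \<Longrightarrow> y \<in> space N \<Longrightarrow> \<bar>c (x, y) - c' (x, y)\<bar> \<le> F x + G y"
    using approx[of "\<epsilon> / 3"] \<epsilon> by auto
  have "integral\<^sup>L P c' \<le> s + \<epsilon> / 3" if P: "P \<in> couplings M N" for P
  proof -
    have i: "integrable P c" "integrable P c'"
      using P c c'(1) by (auto intro: integrable_coupling)
    have "integral\<^sup>L P (\<lambda>z. c' z - c z) \<le> integral\<^sup>L M F + integral\<^sup>L N G"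
      using i close
      by (intro coupling_integral_le[OF P _ FG(1,2)] AE_I2)
        (force simp: abs_le_iff couplingsD(3)[OF P])+
    then have "integral\<^sup>L P c' - integral\<^sup>L P c \<le> \<epsilon> / 3"
      using i FG(3) by simp
    with s[OF P] show ?thesis by simp
  qed
  from sup_dualityE[OF c'(2) this, of "\<epsilon> / 3"] \<epsilon>
  obtain f g where fg: "integrable M f" "integrable N g"
    "\<And>x y. x \<in> space M \<Longrightarrow> y \<in> space N \<Longrightarrow> c' (x, y) \<le> f x + g y"
    "integral\<^sup>L M f + integral\<^sup>L N g \<le> s + \<epsilon> / 3 + \<epsilon> / 3" by auto
  have "\<forall>x\<in>space M. \<forall>y\<in>space N. c (x, y) \<le> (f x + F x) + (g y + G y)"
  proof (intro ballI)
    fix x y assume "x \<in> space M" "y \<in> space N"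
    from fg(3)[OF this] close[OF this] show "c (x, y) \<le> (f x + F x) + (g y + G y)" by linarith
  qed
  moreover have "(\<integral>x. f x + F x \<partial>M) + (\<integral>y. g y + G y \<partial>N) \<le> s + \<epsilon>"
    using fg FG by simp
  ultimately show "\<exists>f g. integrable M f \<and> integrable N g \<and>
      (\<forall>x\<in>space M. \<forall>y\<in>space N. c (x, y) \<le> f x + g y) \<and>
      integral\<^sup>L M f + integral\<^sup>L N g \<le> s + \<epsilon>"
    using fg(1,2) FG(1,2)
    by (intro exI[of _ "\<lambda>x. f x + F x"] exI[of _ "\<lambda>y. g y + G y"]) auto
qed

subsection \<open>Step functions\<close>

lemma (in finite_measure) integral_finite_range:
  fixes \<phi> :: "'i \<Rightarrow> real"
  assumes I: "finite I" and a: "a \<in> M \<rightarrow>\<^sub>M count_space I"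
  shows "integrable M (\<lambda>x. \<phi> (a x))"
    and "(\<integral>x. \<phi> (a x) \<partial>M) = (\<Sum>i\<in>I. measure M (a -` {i} \<inter> space M) * \<phi> i)"
proof -
  have A: "a -` {i} \<inter> space M \<in> sets M" if "i \<in> I" for i
    using that by (intro measurable_sets[OF a]) simp
  have eq: "\<phi> (a x) = (\<Sum>i\<in>I. \<phi> i * indicator (a -` {i} \<inter> space M) x)" if "x \<in> space M" for x
  proof -
    have "(\<Sum>i\<in>I. \<phi> i * indicator (a -` {i} \<inter> space M) x) = (\<Sum>i\<in>I. if i = a x then \<phi> i else 0)"
      using that by (intro sum.cong) (auto simp: indicator_def)
    then show ?thesis using I measurable_space[OF a that] by simp
  qed
  have int: "integrable M (\<lambda>x. \<phi> i * indicator (a -` {i} \<inter> space M) x)" if "i \<in> I" for i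
    using A[OF that] by (intro integrable_mult_right integrable_real_indicator) (auto simp: less_top[symmetric])
  have "integrable M (\<lambda>x. \<Sum>i\<in>I. \<phi> i * indicator (a -` {i} \<inter> space M) x)"
    by (intro Bochner_Integration.integrable_sum int)
  then show "integrable M (\<lambda>x. \<phi> (a x))"
    by (simp only: eq cong: Bochner_Integration.integrable_cong)
  have "(\<integral>x. \<phi> (a x) \<partial>M) = (\<integral>x. (\<Sum>i\<in>I. \<phi> i * indicator (a -` {i} \<inter> space M) x) \<partial>M)"
    by (intro Bochner_Integration.integral_cong refl eq)
  also have "\<dots> = (\<Sum>i\<in>I. \<integral>x. \<phi> i * indicator (a -` {i} \<inter> space M) x \<partial>M)"
    by (intro Bochner_Integration.integral_sum int)
  also have "\<dots> = (\<Sum>i\<in>I. measure M (a -` {i} \<inter> space M) * \<phi> i)"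
    using A by (intro sum.cong refl) (simp add: mult.commute)
  finally show "(\<integral>x. \<phi> (a x) \<partial>M) = (\<Sum>i\<in>I. measure M (a -` {i} \<inter> space M) * \<phi> i)" .
qed

text \<open>There are finitely many level sets, so those of measure zero can be discarded together;
  almost every point lies in a level set whose mass can be divided by.\<close>

lemma (in finite_measure) AE_finite_range_pos:
  assumes I: "finite I" and a: "a \<in> M \<rightarrow>\<^sub>M count_space I"
  shows "AE x in M. a x \<in> I \<and> 0 < measure M (a -` {a x} \<inter> space M)"
proof -
  have "AE x in M. \<forall>i\<in>I. a x = i \<longrightarrow> 0 < measure M (a -` {i} \<inter> space M)"
  proof (intro AE_finite_allI[OF I])
    fix i assume "i \<in> I"
    then have A: "a -` {i} \<inter> space M \<in> sets M"
      by (intro measurable_sets[OF a]) simp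
    show "AE x in M. a x = i \<longrightarrow> 0 < measure M (a -` {i} \<inter> space M)"
    proof (cases "measure M (a -` {i} \<inter> space M) = 0")
      case True
      with A have "a -` {i} \<inter> space M \<in> null_sets M"
        by (simp add: null_sets_def emeasure_eq_measure)
      from AE_not_in[OF this] AE_space show ?thesis by eventually_elim auto
    qed (simp add: zero_less_measure_iff)
  qed
  with AE_space show ?thesis
    by eventually_elim (use measurable_space[OF a] in auto)
qed

context pair_prob_space
begin

lemma measurable_step_function:
  fixes h :: "'i \<Rightarrow> 'j \<Rightarrow> real"
  assumes "finite I" "a \<in> M1 \<rightarrow>\<^sub>M count_space I" "finite J" "b \<in> M2 \<rightarrow>\<^sub>M count_space J"
  shows "(\<lambda>z. h (a (fst z)) (b (snd z))) \<in> borel_measurable (M1 \<Otimes>\<^sub>M M2)"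
proof (rule measurable_compose_countable'[where f = "\<lambda>i z. h i (b (snd z))" and I = I])
  show "(\<lambda>z. a (fst z)) \<in> M1 \<Otimes>\<^sub>M M2 \<rightarrow>\<^sub>M count_space I"
    using assms(2) by (rule measurable_compose[OF measurable_fst])
  show "(\<lambda>z. h i (b (snd z))) \<in> borel_measurable (M1 \<Otimes>\<^sub>M M2)" for i
    using measurable_compose[OF measurable_compose[OF measurable_snd assms(4)], of "h i" borel]
    by simp
qed (use assms in \<open>auto intro: countable_finite\<close>)

lemma sum_dominated_step_function:
  fixes h :: "'i \<Rightarrow> 'j \<Rightarrow> real"
  assumes I: "finite I" "a \<in> M1 \<rightarrow>\<^sub>M count_space I" and J: "finite J" "b \<in> M2 \<rightarrow>\<^sub>M count_space J"
  shows "sum_dominated M1 M2 (\<lambda>z. h (a (fst z)) (b (snd z)))"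
  unfolding sum_dominated_def
proof (intro conjI exI ballI)
  show "(\<lambda>z. h (a (fst z)) (b (snd z))) \<in> borel_measurable (M1 \<Otimes>\<^sub>M M2)"
    using assms by (rule measurable_step_function)
  show "integrable M1 (\<lambda>x. 0)" "integrable M2 (\<lambda>y. \<Sum>i\<in>I. \<Sum>j\<in>J. \<bar>h i j\<bar>)"
    by simp_all
  fix x y assume "x \<in> space M1" "y \<in> space M2"
  then have "a x \<in> I" "b y \<in> J"
    using measurable_space[OF I(2)] measurable_space[OF J(2)] by auto
  then have "\<bar>h (a x) (b y)\<bar> \<le> (\<Sum>j\<in>J. \<bar>h (a x) j\<bar>)" "(\<Sum>j\<in>J. \<bar>h (a x) j\<bar>) \<le> (\<Sum>i\<in>I. \<Sum>j\<in>J. \<bar>h i j\<bar>)"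
    using I(1) J(1)
    by (auto intro!: member_le_sum[of "b y" J "\<lambda>j. \<bar>h (a x) j\<bar>"]
        member_le_sum[of "a x" I "\<lambda>i. \<Sum>j\<in>J. \<bar>h i j\<bar>"] sum_nonneg)
  then show "\<bar>h (a (fst (x, y))) (b (snd (x, y)))\<bar> \<le> 0 + (\<Sum>i\<in>I. \<Sum>j\<in>J. \<bar>h i j\<bar>)"
    by simp
qed

text \<open>A coupling matrix \<open>\<pi>\<close> of the laws of \<open>a\<close> and \<open>b\<close> lifts to a coupling of \<open>M1\<close> and \<open>M2\<close> with
  density \<open>\<pi> i j / (p i * q j)\<close> on the product of the level sets of \<open>i\<close> and \<open>j\<close>; where a denominator
  vanishes, so does \<open>\<pi> i j\<close>.\<close>

lemma sup_duality_step_function: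
  fixes h :: "'i \<Rightarrow> 'j \<Rightarrow> real"
  assumes I: "finite I" "a \<in> M1 \<rightarrow>\<^sub>M count_space I" and J: "finite J" "b \<in> M2 \<rightarrow>\<^sub>M count_space J"
  shows "sup_duality M1 M2 (\<lambda>z. h (a (fst z)) (b (snd z)))"
proof (rule sup_dualityI)
  fix s \<epsilon> :: real
  assume s: "\<And>P. P \<in> couplings M1 M2 \<Longrightarrow> (\<integral>z. h (a (fst z)) (b (snd z)) \<partial>P) \<le> s"
    and \<epsilon>: "0 < \<epsilon>"
  define p q where "p i = measure M1 (a -` {i} \<inter> space M1)"
    and "q j = measure M2 (b -` {j} \<inter> space M2)" for i j
  have p_int: "(\<integral>x. \<phi> (a x) \<partial>M1) = (\<Sum>i\<in>I. p i * \<phi> i)" for \<phi>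
    unfolding p_def using I by (rule M1.integral_finite_range(2))
  have q_int: "(\<integral>y. \<phi> (b y) \<partial>M2) = (\<Sum>j\<in>J. q j * \<phi> j)" for \<phi>
    unfolding q_def using J by (rule M2.integral_finite_range(2))
  have nonneg: "0 \<le> p i" "0 \<le> q j" for i j by (simp_all add: p_def q_def)
  have "sum p I = 1" "sum q J = 1"
    using p_int[of "\<lambda>_. 1"] q_int[of "\<lambda>_. 1"] by (simp_all add: M1.prob_space M2.prob_space)
  note transport = finite_transport_duality[OF I(1) J(1) nonneg(1) this(1) nonneg(2) this(2) _ \<epsilon>]
  have "(\<Sum>i\<in>I. \<Sum>j\<in>J. \<pi> i j * h i j) \<le> s"
    if \<pi>: "\<And>i j. i \<in> I \<Longrightarrow> j \<in> J \<Longrightarrow> 0 \<le> \<pi> i j"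
      and row: "\<And>i. i \<in> I \<Longrightarrow> (\<Sum>j\<in>J. \<pi> i j) = p i"
      and col: "\<And>j. j \<in> J \<Longrightarrow> (\<Sum>i\<in>I. \<pi> i j) = q j" for \<pi>
  proof -
    define w where "w i j = \<pi> i j / (p i * q j)" for i j
    have w: "0 \<le> w i j" if "i \<in> I" "j \<in> J" for i j
      using \<pi> that nonneg by (simp add: w_def)
    \<comment> \<open>An entry of \<open>\<pi>\<close> is at most its row sum and its column sum, so
      it vanishes where \<open>p i * q j = 0\<close>. There \<open>w\<close> has the default value 0
      of a division by zero, and \<open>w_mult\<close> remains true.\<close>
    have \<pi>_le: "\<pi> i j \<le> p i" "\<pi> i j \<le> q j" if "i \<in> I" "j \<in> J" for i j
      using that I(1) J(1) \<pi>
      by (auto simp: row[symmetric] col[symmetric]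
          intro!: member_le_sum[of j J "\<pi> i"] member_le_sum[of i I "\<lambda>i. \<pi> i j"])
    have w_mult: "w i j * (p i * q j) = \<pi> i j" if "i \<in> I" "j \<in> J" for i j
      using \<pi>_le[OF that] \<pi>[OF that] by (auto simp: w_def)
    have row_w: "(\<Sum>j\<in>J. q j * w i j) = 1" if "i \<in> I" "0 < p i" for i
    proof -
      have "p i * (\<Sum>j\<in>J. q j * w i j) = (\<Sum>j\<in>J. w i j * (p i * q j))"
        by (simp add: sum_distrib_left algebra_simps)
      also have "\<dots> = p i" using that w_mult by (simp add: row)
      finally show ?thesis using that by simp
    qed
    have col_w: "(\<Sum>i\<in>I. p i * w i j) = 1" if "j \<in> J" "0 < q j" for j
    proof -
      have "q j * (\<Sum>i\<in>I. p i * w i j) = (\<Sum>i\<in>I. w i j * (p i * q j))"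
        by (simp add: sum_distrib_left algebra_simps)
      also have "\<dots> = q j" using that w_mult by (simp add: col)
      finally show ?thesis using that by simp
    qed
    define W where "W z = w (a (fst z)) (b (snd z))" for z
    have W_meas[measurable]: "W \<in> borel_measurable (M1 \<Otimes>\<^sub>M M2)"
      unfolding W_def using I J by (rule measurable_step_function)
    have a_in: "a x \<in> I" if "x \<in> space M1" for x using measurable_space[OF I(2) that] by simp
    have b_in: "b y \<in> J" if "y \<in> space M2" for y using measurable_space[OF J(2) that] by simp
    have W_nonneg: "0 \<le> W z" if "z \<in> space (M1 \<Otimes>\<^sub>M M2)" for z
      using that w a_in b_in by (auto simp: W_def space_pair_measure)
    define P where "P = density (M1 \<Otimes>\<^sub>M M2) (\<lambda>z. ennreal (W z))"
    have marginal1: "emeasure P (A \<times> space M2) = emeasure M1 A" if A: "A \<in> sets M1" for A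
    proof -
      have "emeasure P (A \<times> space M2)
          = (\<integral>\<^sup>+ z. ennreal (W z) * indicator (A \<times> space M2) z \<partial>(M1 \<Otimes>\<^sub>M M2))"
        unfolding P_def using A by (intro emeasure_density) auto
      also have "\<dots> = (\<integral>\<^sup>+ x. \<integral>\<^sup>+ y. ennreal (W (x, y)) * indicator (A \<times> space M2) (x, y) \<partial>M2 \<partial>M1)"
        using A by (intro M2.nn_integral_fst[symmetric]) auto
      also have "\<dots> = (\<integral>\<^sup>+ x. indicator A x \<partial>M1)"
      proof (rule nn_integral_cong_AE)
        show "AE x in M1. (\<integral>\<^sup>+ y. ennreal (W (x, y)) * indicator (A \<times> space M2) (x, y) \<partial>M2)
            = indicator A x"
          \<comment> \<open>The row identity \<open>row_w\<close> is available for level sets of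
            positive mass, and these contain almost every \<open>x\<close>.\<close>
          using M1.AE_finite_range_pos[OF I] AE_space
        proof eventually_elim
          case (elim x)
          have "(\<integral>\<^sup>+ y. ennreal (W (x, y)) * indicator (A \<times> space M2) (x, y) \<partial>M2)
              = (\<integral>\<^sup>+ y. indicator A x * ennreal (w (a x) (b y)) \<partial>M2)"
            by (intro nn_integral_cong) (auto simp: W_def indicator_def)
          also have "\<dots> = indicator A x * (\<integral>\<^sup>+ y. ennreal (w (a x) (b y)) \<partial>M2)"
            using M2.integral_finite_range(1)[OF J] by (intro nn_integral_cmult) auto
          also have "(\<integral>\<^sup>+ y. ennreal (w (a x) (b y)) \<partial>M2) = ennreal (\<integral>y. w (a x) (b y) \<partial>M2)"
            using M2.integral_finite_range(1)[OF J] w b_in elim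
            by (intro nn_integral_eq_integral) auto
          also have "(\<integral>y. w (a x) (b y) \<partial>M2) = 1"
            using elim row_w by (simp add: q_int p_def)
          finally show ?case by simp
        qed
      qed
      finally show ?thesis using A by simp
    qed
    have marginal2: "emeasure P (space M1 \<times> B) = emeasure M2 B" if B: "B \<in> sets M2" for B
    proof -
      have "emeasure P (space M1 \<times> B)
          = (\<integral>\<^sup>+ z. ennreal (W z) * indicator (space M1 \<times> B) z \<partial>(M1 \<Otimes>\<^sub>M M2))"
        unfolding P_def using B by (intro emeasure_density) auto
      also have "\<dots> = (\<integral>\<^sup>+ y. \<integral>\<^sup>+ x. ennreal (W (x, y)) * indicator (space M1 \<times> B) (x, y) \<partial>M1 \<partial>M2)"
        using B by (intro nn_integral_snd[symmetric]) auto
      also have "\<dots> = (\<integral>\<^sup>+ y. indicator B y \<partial>M2)"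
      proof (rule nn_integral_cong_AE)
        show "AE y in M2. (\<integral>\<^sup>+ x. ennreal (W (x, y)) * indicator (space M1 \<times> B) (x, y) \<partial>M1)
            = indicator B y"
          using M2.AE_finite_range_pos[OF J] AE_space
        proof eventually_elim
          case (elim y)
          have "(\<integral>\<^sup>+ x. ennreal (W (x, y)) * indicator (space M1 \<times> B) (x, y) \<partial>M1)
              = (\<integral>\<^sup>+ x. indicator B y * ennreal (w (a x) (b y)) \<partial>M1)"
            by (intro nn_integral_cong) (auto simp: W_def indicator_def)
          also have "\<dots> = indicator B y * (\<integral>\<^sup>+ x. ennreal (w (a x) (b y)) \<partial>M1)"
            using M1.integral_finite_range(1)[OF I, of "\<lambda>i. w i (b y)"] by (intro nn_integral_cmult) auto
          also have "(\<integral>\<^sup>+ x. ennreal (w (a x) (b y)) \<partial>M1) = ennreal (\<integral>x. w (a x) (b y) \<partial>M1)"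
            using M1.integral_finite_range(1)[OF I, of "\<lambda>i. w i (b y)"] w a_in elim
            by (intro nn_integral_eq_integral) auto
          also have "(\<integral>x. w (a x) (b y) \<partial>M1) = 1"
            using elim col_w p_int[of "\<lambda>i. w i (b y)"] by (simp add: q_def)
          finally show ?case by simp
        qed
      qed
      finally show ?thesis using B by simp
    qed
    have "prob_space P"
      using marginal1[of "space M1"]
      by (intro prob_spaceI) (simp add: P_def space_pair_measure M1.emeasure_space_1)
    with marginal1 marginal2 have P: "P \<in> couplings M1 M2"
      by (simp add: couplings_def P_def)
    have "(\<integral>z. h (a (fst z)) (b (snd z)) \<partial>P)
        = (\<integral>z. W z * h (a (fst z)) (b (snd z)) \<partial>(M1 \<Otimes>\<^sub>M M2))"
      unfolding P_def using W_nonneg measurable_step_function[OF I J, of h]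
      by (subst integral_density) auto
    also have "\<dots> = (\<integral>x. \<integral>y. w (a x) (b y) * h (a x) (b y) \<partial>M2 \<partial>M1)"
    proof -
      have "sum_dominated M1 M2 (\<lambda>z. (\<lambda>i j. w i j * h i j) (a (fst z)) (b (snd z)))"
        using I J by (rule sum_dominated_step_function)
      moreover have "M1 \<Otimes>\<^sub>M M2 \<in> couplings M1 M2"
        by (simp add: couplings_def prob_space_axioms M2.emeasure_pair_measure_Times
            M1.emeasure_space_1 M2.emeasure_space_1)
      ultimately have "integrable (M1 \<Otimes>\<^sub>M M2) (\<lambda>z. w (a (fst z)) (b (snd z)) * h (a (fst z)) (b (snd z)))"
        using integrable_coupling by blast
      from integral_fst'[OF this] show ?thesis by (simp add: W_def)
    qed
    also have "\<dots> = (\<Sum>i\<in>I. p i * (\<Sum>j\<in>J. q j * (w i j * h i j)))"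
      using p_int[of "\<lambda>i. \<Sum>j\<in>J. q j * (w i j * h i j)"]
        q_int[of "\<lambda>j. w i j * h i j" for i] by simp
    also have "\<dots> = (\<Sum>i\<in>I. \<Sum>j\<in>J. (w i j * (p i * q j)) * h i j)"
      by (simp add: sum_distrib_left algebra_simps)
    also have "\<dots> = (\<Sum>i\<in>I. \<Sum>j\<in>J. \<pi> i j * h i j)"
      using w_mult by simp
    finally show ?thesis using s[OF P] by simp
  qed
  from transport[OF this]
  obtain u v where u: "\<And>i j. i \<in> I \<Longrightarrow> j \<in> J \<Longrightarrow> h i j \<le> u i + v j"
    and uv: "(\<Sum>i\<in>I. p i * u i) + (\<Sum>j\<in>J. q j * v j) \<le> s + \<epsilon>" by blast
  \<comment> \<open>Since \<open>a\<close> and \<open>b\<close> take values in \<open>I\<close> and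
    \<open>J\<close> on the whole spaces, the finite potentials pull back to a dual pair that is
    feasible at every point.\<close>
  have "\<forall>x\<in>space M1. \<forall>y\<in>space M2. h (a x) (b y) \<le> u (a x) + v (b y)"
    using u measurable_space[OF I(2)] measurable_space[OF J(2)] by auto
  then show "\<exists>f g. integrable M1 f \<and> integrable M2 g \<and>
      (\<forall>x\<in>space M1. \<forall>y\<in>space M2. h (a (fst (x, y))) (b (snd (x, y))) \<le> f x + g y) \<and>
      integral\<^sup>L M1 f + integral\<^sup>L M2 g \<le> s + \<epsilon>"
    using uv M1.integral_finite_range(1)[OF I, of u] M2.integral_finite_range(1)[OF J, of v]
    by (intro exI[of _ "\<lambda>x. u (a x)"] exI[of _ "\<lambda>y. v (b y)"]) (simp add: p_int q_int)
qed

end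

subsection \<open>Increasing limits of bounded costs\<close>

text \<open>Outside a null set \<open>N\<close> the function \<open>F\<close> is the pointwise
  limit; on \<open>N\<close> it has the default value \<open>b\<close>, left free so that an
  inequality lost on \<open>N\<close> can be restored by a large choice. The predicate
  \<open>P\<close> lets a further almost sure property share the same exceptional set.\<close>

lemma (in prob_space) bounded_AE_limit_integral:
  fixes f :: "nat \<Rightarrow> 'a \<Rightarrow> real"
  assumes f: "\<And>n. f n \<in> borel_measurable M"
    and B: "\<And>n x. x \<in> space M \<Longrightarrow> \<bar>f n x\<bar> \<le> B" "B \<le> b"
    and good: "AE x in M. Cauchy (\<lambda>n. f n x) \<and> P x"
  obtains F N where "integrable M F" "N \<subseteq> space M"
    "\<And>x. x \<in> space M \<Longrightarrow> - B \<le> F x" "\<And>x. x \<in> N \<Longrightarrow> F x = b"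
    "\<And>x. x \<in> space M - N \<Longrightarrow> P x \<and> (\<lambda>n. f n x) \<longlonglongrightarrow> F x"
    "(\<lambda>n. integral\<^sup>L M (f n)) \<longlonglongrightarrow> integral\<^sup>L M F"
proof -
  obtain N where N: "{x\<in>space M. \<not> (Cauchy (\<lambda>n. f n x) \<and> P x)} \<subseteq> N" "emeasure M N = 0" "N \<in> sets M"
    using AE_E[OF good] .
  define F where "F x = (if x \<in> N then b else lim (\<lambda>n. f n x))" for x
  have lim: "(\<lambda>n. f n x) \<longlonglongrightarrow> F x" if "x \<in> space M - N" for x
    using that N(1) by (auto simp: F_def Cauchy_convergent_iff convergent_LIMSEQ_iff)
  have B0: "0 \<le> B" using not_empty B(1) abs_ge_zero order_trans by blast
  have F_meas: "F \<in> borel_measurable M"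
    unfolding F_def using N(3) f by (intro measurable_If_set borel_measurable_lim_metric) auto
  have F_abs: "\<bar>F x\<bar> \<le> B" if "x \<in> space M - N" for x
    using that B(1) by (intro LIMSEQ_le_const2[OF tendsto_rabs[OF lim[OF that]]]) auto
  have AE: "AE x in M. x \<notin> N" using N by (intro AE_not_in) (auto simp: null_sets_def)
  show thesis
  proof (rule that[of F N])
    show "integrable M F"
      using AE AE_space F_abs
      by (intro integrable_const_bound[OF _ F_meas, of B]) (auto elim!: eventually_elim2)
    show "N \<subseteq> space M" using N(3) by (rule sets.sets_into_space)
    show "- B \<le> F x" if "x \<in> space M" for x
    proof (cases "x \<in> N")
      case True
      then show ?thesis using B0 B(2) by (simp add: F_def)
    next
      case False
      then show ?thesis using F_abs[of x] that by auto
    qed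
    show "F x = b" if "x \<in> N" for x using that by (simp add: F_def)
    show "P x \<and> (\<lambda>n. f n x) \<longlonglongrightarrow> F x" if "x \<in> space M - N" for x
      using that N(1) lim by auto
    show "(\<lambda>n. integral\<^sup>L M (f n)) \<longlonglongrightarrow> integral\<^sup>L M F"
    proof (rule integral_dominated_convergence[where w = "\<lambda>x. B"])
      show "AE x in M. (\<lambda>n. f n x) \<longlonglongrightarrow> F x"
        using AE AE_space lim by (auto elim!: eventually_elim2)
    qed (use F_meas f B in auto)
  qed
qed

section \<open>Selection of convergent dual potentials in the Hilbert norm\<close>

context pair_prob_space
begin

text \<open>Near-minimizers of the Hilbert norm over a decreasing sequence of convex sets form a Cauchy
  sequence, by the parallelogram identity.\<close>

lemma nested_midpoint_convex_cauchy:
  fixes C :: "nat \<Rightarrow> ('a \<Rightarrow> real) \<Rightarrow> ('b \<Rightarrow> real) \<Rightarrow> bool"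
  assumes nonempty: "\<And>n. \<exists>f g. C n f g"
    and decreasing: "\<And>n f g. C (Suc n) f g \<Longrightarrow> C n f g"
    and midpoint: "\<And>n f g f' g'. C n f g \<Longrightarrow> C n f' g' \<Longrightarrow>
      C n (\<lambda>x. (f x + f' x) / 2) (\<lambda>y. (g y + g' y) / 2)"
    and measurable: "\<And>n f g. C n f g \<Longrightarrow> f \<in> borel_measurable M1 \<and> g \<in> borel_measurable M2"
    and bounded: "\<And>n f g x. C n f g \<Longrightarrow> x \<in> space M1 \<Longrightarrow> \<bar>f x\<bar> \<le> B"
      "\<And>n f g y. C n f g \<Longrightarrow> y \<in> space M2 \<Longrightarrow> \<bar>g y\<bar> \<le> B"
  obtains fs gs where "\<And>n. C n (fs n) (gs n)"
    and "AE x in M1. Cauchy (\<lambda>n. fs n x)" and "AE y in M2. Cauchy (\<lambda>n. gs n y)"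
proof -
  have antimono: "C n f g" if "C m f g" "n \<le> m" for n m f g
    using that(2,1) by (induction rule: dec_induct) (auto intro: decreasing)
  define N where "N f g = (\<integral>x. (f x)\<^sup>2 \<partial>M1) + (\<integral>y. (g y)\<^sup>2 \<partial>M2)"
    for f :: "'a \<Rightarrow> real" and g :: "'b \<Rightarrow> real"
  have int: "integrable M1 (\<lambda>x. f x * f' x)" "integrable M2 (\<lambda>y. g y * g' y)"
    "integrable M1 f" "integrable M2 g"
    if C: "C n f g" "C m f' g'" for n m f g f' g'
  proof -
    have B: "\<bar>a * b\<bar> \<le> B * B" if "\<bar>a\<bar> \<le> B" "\<bar>b\<bar> \<le> B" for a b :: real
      using that unfolding abs_mult by (intro mult_mono) auto
    note meas[measurable] = measurable[OF C(1), THEN conjunct1] measurable[OF C(1), THEN conjunct2]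
      measurable[OF C(2), THEN conjunct1] measurable[OF C(2), THEN conjunct2]
    show "integrable M1 (\<lambda>x. f x * f' x)"
      using bounded(1)[OF C(1)] bounded(1)[OF C(2)]
      by (intro M1.integrable_const_bound[where B = "B * B"] AE_I2) (auto intro: B)
    show "integrable M2 (\<lambda>y. g y * g' y)"
      using bounded(2)[OF C(1)] bounded(2)[OF C(2)]
      by (intro M2.integrable_const_bound[where B = "B * B"] AE_I2) (auto intro: B)
    show "integrable M1 f"
      using bounded(1)[OF C(1)] by (intro M1.integrable_const_bound[where B = B] AE_I2) auto
    show "integrable M2 g"
      using bounded(2)[OF C(1)] by (intro M2.integrable_const_bound[where B = B] AE_I2) auto
  qed
  have N_nonneg: "0 \<le> N f g" for f g
    unfolding N_def by (intro add_nonneg_nonneg integral_nonneg) auto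
  have N_bound: "N f g \<le> 2 * B\<^sup>2" if C: "C n f g" for n f g
  proof -
    have "(\<integral>x. (f x)\<^sup>2 \<partial>M1) \<le> (\<integral>x. B\<^sup>2 \<partial>M1)"
      using int[OF C C] bounded(1)[OF C]
      by (intro integral_mono) (auto simp: power2_eq_square[symmetric] abs_le_square_iff[symmetric]
          intro: order_trans[OF _ abs_ge_self])
    moreover have "(\<integral>y. (g y)\<^sup>2 \<partial>M2) \<le> (\<integral>y. B\<^sup>2 \<partial>M2)"
      using int[OF C C] bounded(2)[OF C]
      by (intro integral_mono) (auto simp: power2_eq_square[symmetric] abs_le_square_iff[symmetric]
          intro: order_trans[OF _ abs_ge_self])
    ultimately show ?thesis
      by (simp add: N_def M1.prob_space M2.prob_space)
  qed
  define V where "V n = {N f g | f g. C n f g}" for n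
  define d where "d n = Inf (V n)" for n
  have V_ne: "V n \<noteq> {}" for n using nonempty[of n] by (auto simp: V_def)
  have V_bdd: "bdd_below (V n)" for n
    using N_nonneg by (intro bdd_belowI[of _ 0]) (auto simp: V_def)
  have d_le: "d n \<le> N f g" if "C n f g" for n f g
    unfolding d_def using that by (intro cInf_lower[OF _ V_bdd]) (auto simp: V_def)
  \<comment> \<open>The sets \<open>V n\<close> shrink, so their infima increase. Being bounded they
    converge, which makes near-minimizers of different indices comparable.\<close>
  have "incseq d"
    unfolding d_def
    by (intro incseq_SucI cInf_superset_mono V_ne V_bdd) (auto simp: V_def dest!: decreasing)
  moreover have "d n \<le> 2 * B\<^sup>2" for n
    using nonempty[of n] d_le[of n] N_bound[of n] by (meson order_trans)
  ultimately obtain L where "d \<longlonglongrightarrow> L"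
    using incseq_convergent[of d "2 * B\<^sup>2"] by blast
  then have d_Cauchy: "Cauchy d" by (rule LIMSEQ_imp_Cauchy)
  have "\<exists>f g. C n f g \<and> N f g < d n + 1 / real (Suc n)" for n
  proof -
    have "Inf (V n) < d n + 1 / real (Suc n)" by (simp add: d_def)
    from cInf_lessD[OF V_ne this] show ?thesis by (auto simp: V_def)
  qed
  then obtain fs gs where C: "\<And>n. C n (fs n) (gs n)" and near: "\<And>n. N (fs n) (gs n) < d n + 1 / real (Suc n)"
    by metis
  \<comment> \<open>Since \<open>n \<le> m\<close>, both pairs satisfy \<open>C n\<close>, and so
    does their midpoint, whose squared norm is therefore at least \<open>d n\<close>. The
    parallelogram identity turns this lower bound into an upper bound for the difference.\<close>
  have dist: "N (\<lambda>x. fs m x - fs n x) (\<lambda>y. gs m y - gs n y)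
      \<le> 2 * \<bar>d m - d n\<bar> + 4 / real (Suc n)" if "n \<le> m" for m n
  proof -
    have Cm: "C n (fs m) (gs m)" using antimono[OF C that] .
    have "d n \<le> N (\<lambda>x. (fs m x + fs n x) / 2) (\<lambda>y. (gs m y + gs n y) / 2)"
      using Cm C by (intro d_le midpoint)
    also have "\<dots> = (N (fs m) (gs m) + N (fs n) (gs n)) / 2
        - N (\<lambda>x. fs m x - fs n x) (\<lambda>y. gs m y - gs n y) / 4"
      using int[OF Cm Cm] int[OF C[of n] C[of n]] int[OF Cm C[of n]]
      by (simp add: N_def power2_eq_square algebra_simps add_divide_distrib diff_divide_distrib)
    finally have "N (\<lambda>x. fs m x - fs n x) (\<lambda>y. gs m y - gs n y)
        \<le> 2 * N (fs m) (gs m) + 2 * N (fs n) (gs n) - 4 * d n" by (simp add: field_simps)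
    also have "\<dots> \<le> 2 * (d m + 1 / real (Suc m)) + 2 * (d n + 1 / real (Suc n)) - 4 * d n"
      using near[of m] near[of n] by (intro diff_right_mono add_mono mult_left_mono) auto
    also have "\<dots> = 2 * (d m - d n) + 2 * (1 / real (Suc m)) + 2 * (1 / real (Suc n))"
      by (simp add: algebra_simps)
    also have "\<dots> \<le> 2 * \<bar>d m - d n\<bar> + 2 * (1 / real (Suc n)) + 2 * (1 / real (Suc n))"
      using that by (intro add_mono mult_left_mono) (auto simp: field_simps)
    finally show ?thesis by simp
  qed
  have L2: "\<exists>k. \<forall>m\<ge>k. \<forall>n\<ge>k. N (\<lambda>x. fs m x - fs n x) (\<lambda>y. gs m y - gs n y) < e"
    if e: "0 < e" for e
  proof -
    define h where "h = e / 8"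
    have h: "0 < h" "e = 8 * h" using e by (auto simp: h_def)
    obtain k1 where k1: "\<And>m n. k1 \<le> m \<Longrightarrow> k1 \<le> n \<Longrightarrow> \<bar>d m - d n\<bar> < h"
      using d_Cauchy h(1) unfolding Cauchy_def dist_real_def by blast
    obtain k2 where k2: "inverse (real (Suc k2)) < h"
      using reals_Archimedean[OF h(1)] by auto
    have *: "N (\<lambda>x. fs m x - fs n x) (\<lambda>y. gs m y - gs n y) < e"
      if "max k1 k2 \<le> n" "n \<le> m" for m n
    proof -
      have "inverse (real (Suc n)) \<le> inverse (real (Suc k2))"
        using that by (intro le_imp_inverse_le) auto
      with k2 have "inverse (real (Suc n)) < h" by (rule order.strict_trans1[rotated])
      then have "4 / real (Suc n) < 4 * h" by (simp add: divide_inverse)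
      moreover have "\<bar>d m - d n\<bar> < h" using that by (intro k1) auto
      ultimately have "2 * \<bar>d m - d n\<bar> + 4 / real (Suc n) < 2 * h + 4 * h"
        by (intro add_strict_mono) auto
      also have "\<dots> < e" using h by simp
      finally show ?thesis using dist[OF that(2)] by (rule order.strict_trans1[rotated])
    qed
    have sym: "N (\<lambda>x. fs m x - fs n x) (\<lambda>y. gs m y - gs n y)
        = N (\<lambda>x. fs n x - fs m x) (\<lambda>y. gs n y - gs m y)" for m n
      by (simp add: N_def power2_commute)
    show ?thesis
      using * sym by (intro exI[of _ "max k1 k2"] allI impI) (metis nle_le)
  qed
  \<comment> \<open>Almost everywhere convergent subsequences are extracted from sequences that are
    Cauchy in mean. The inequality \<open>am\<close> plays the part of Cauchy-Schwarz on a
    probability space: with squared norm below \<open>e * e\<close>, its second term contributes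
    less than \<open>e / 2\<close>.\<close>
  have L1: "\<exists>k. \<forall>m\<ge>k. \<forall>n\<ge>k. (\<integral>x. norm (fs m x - fs n x) \<partial>M1) < e"
    "\<exists>k. \<forall>m\<ge>k. \<forall>n\<ge>k. (\<integral>y. norm (gs m y - gs n y) \<partial>M2) < e"
    if e: "0 < e" for e
  proof -
    have am: "norm t \<le> e / 2 + t * t / (2 * e)" for t
    proof -
      have "0 \<le> (\<bar>t\<bar> - e)\<^sup>2" by simp
      with e show ?thesis by (simp add: power2_diff field_simps power2_eq_square)
    qed
    obtain k where k: "\<And>m n. k \<le> m \<Longrightarrow> k \<le> n \<Longrightarrow>
        N (\<lambda>x. fs m x - fs n x) (\<lambda>y. gs m y - gs n y) < e * e"
      using L2[of "e * e"] e by auto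
    have "(\<integral>x. norm (fs m x - fs n x) \<partial>M1) < e \<and> (\<integral>y. norm (gs m y - gs n y) \<partial>M2) < e"
      if "k \<le> m" "k \<le> n" for m n
    proof -
      let ?a = "\<integral>x. (fs m x - fs n x) * (fs m x - fs n x) \<partial>M1"
      let ?b = "\<integral>y. (gs m y - gs n y) * (gs m y - gs n y) \<partial>M2"
      have i: "integrable M1 (\<lambda>x. fs m x - fs n x)" "integrable M2 (\<lambda>y. gs m y - gs n y)"
        "integrable M1 (\<lambda>x. (fs m x - fs n x) * (fs m x - fs n x))"
        "integrable M2 (\<lambda>y. (gs m y - gs n y) * (gs m y - gs n y))"
        using int[OF C[of m] C[of m]] int[OF C[of n] C[of n]] int[OF C[of m] C[of n]]
          int[OF C[of n] C[of m]]
        by (auto simp: algebra_simps)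
      have nonneg: "0 \<le> ?a" "0 \<le> ?b" by (auto intro!: integral_nonneg)
      have "?a + ?b < e * e" using k[OF that] by (simp add: N_def power2_eq_square)
      with nonneg have ab: "?a < e * e" "?b < e * e" by linarith+
      have "(\<integral>x. norm (fs m x - fs n x) \<partial>M1)
          \<le> (\<integral>x. e / 2 + (fs m x - fs n x) * (fs m x - fs n x) / (2 * e) \<partial>M1)"
        using i am by (intro integral_mono) auto
      also have "\<dots> = e / 2 + ?a / (2 * e)"
        using i by (simp add: M1.prob_space)
      also have "\<dots> < e / 2 + e * e / (2 * e)"
        using ab e by (intro add_strict_left_mono divide_strict_right_mono) auto
      finally have 1: "(\<integral>x. norm (fs m x - fs n x) \<partial>M1) < e" using e by simp
      have "(\<integral>y. norm (gs m y - gs n y) \<partial>M2)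
          \<le> (\<integral>y. e / 2 + (gs m y - gs n y) * (gs m y - gs n y) / (2 * e) \<partial>M2)"
        using i am by (intro integral_mono) auto
      also have "\<dots> = e / 2 + ?b / (2 * e)"
        using i by (simp add: M2.prob_space)
      also have "\<dots> < e / 2 + e * e / (2 * e)"
        using ab e by (intro add_strict_left_mono divide_strict_right_mono) auto
      finally have "(\<integral>y. norm (gs m y - gs n y) \<partial>M2) < e" using e by simp
      with 1 show ?thesis by simp
    qed
    then show "\<exists>k. \<forall>m\<ge>k. \<forall>n\<ge>k. (\<integral>x. norm (fs m x - fs n x) \<partial>M1) < e"
      "\<exists>k. \<forall>m\<ge>k. \<forall>n\<ge>k. (\<integral>y. norm (gs m y - gs n y) \<partial>M2) < e" by blast+
  qed
  obtain r1 where r1: "strict_mono r1" "AE x in M1. Cauchy (\<lambda>i. fs (r1 i) x)"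
    using cauchy_L1_AE_cauchy_subseq[of M1 fs] int(3)[OF C C] L1(1) by blast
  have "\<exists>k. \<forall>m\<ge>k. \<forall>n\<ge>k. (\<integral>y. norm (gs (r1 m) y - gs (r1 n) y) \<partial>M2) < e" if "0 < e" for e
    using L1(2)[OF that] by (meson order_trans seq_suble[OF r1(1)])
  then obtain r2 where r2: "strict_mono r2" "AE y in M2. Cauchy (\<lambda>i. gs (r1 (r2 i)) y)"
    using cauchy_L1_AE_cauchy_subseq[of M2 "\<lambda>i. gs (r1 i)"] int(4)[OF C C] by blast
  show thesis
  proof (rule that)
    \<comment> \<open>Passing to a subsequence only increases the index, and the constraints are
      nested, so the \<open>n\<close>-th selected pair still satisfies \<open>C n\<close>.\<close>
    have "n \<le> r1 (r2 n)" for n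
      using seq_suble[OF r2(1), of n] seq_suble[OF r1(1), of "r2 n"] by simp
    then show "C n (fs (r1 (r2 n))) (gs (r1 (r2 n)))" for n
      using C antimono by blast
    show "AE x in M1. Cauchy (\<lambda>n. fs (r1 (r2 n)) x)"
      using r1(2) by eventually_elim (use Cauchy_subseq_Cauchy[OF _ r2(1)] in \<open>auto simp: comp_def\<close>)
    show "AE y in M2. Cauchy (\<lambda>n. gs (r1 (r2 n)) y)" by (rule r2(2))
  qed
qed

text \<open>A constant can be moved between the potentials. Moving the infimum \<open>m\<close> of
  \<open>f\<close> makes the first one nonnegative and the second at least \<open>- K\<close>.
  Cutting them from above at \<open>2 * K\<close> and \<open>K\<close> preserves the constraint:
  where a cut is active, the sum is at least \<open>2 * K - K\<close> or \<open>0 + K\<close>, hence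
  at least \<open>c\<close>. Cuts do not increase integrals, and the shifts cancel because both
  measures have mass one.\<close>

lemma bounded_potentials:
  assumes K: "\<And>x y. x \<in> space M1 \<Longrightarrow> y \<in> space M2 \<Longrightarrow> \<bar>c (x, y)\<bar> \<le> (K::real)"
    and f: "integrable M1 f" and g: "integrable M2 g"
    and le: "\<And>x y. x \<in> space M1 \<Longrightarrow> y \<in> space M2 \<Longrightarrow> c (x, y) \<le> f x + g y"
  obtains f' g' where "f' \<in> borel_measurable M1" "g' \<in> borel_measurable M2"
    and "\<And>x. x \<in> space M1 \<Longrightarrow> \<bar>f' x\<bar> \<le> 2 * K" "\<And>y. y \<in> space M2 \<Longrightarrow> \<bar>g' y\<bar> \<le> 2 * K"
    and "\<And>x y. x \<in> space M1 \<Longrightarrow> y \<in> space M2 \<Longrightarrow> c (x, y) \<le> f' x + g' y"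
    and "integral\<^sup>L M1 f' + integral\<^sup>L M2 g' \<le> integral\<^sup>L M1 f + integral\<^sup>L M2 g"
proof -
  obtain x0 y0 where xy0: "x0 \<in> space M1" "y0 \<in> space M2"
    using M1.not_empty M2.not_empty by blast
  have K0: "0 \<le> K" using K[OF xy0] by simp
  have lower: "- K - g y \<le> f x" if "x \<in> space M1" "y \<in> space M2" for x y
    using K[OF that] le[OF that] by linarith
  define m where "m = (INF x\<in>space M1. f x)"
  have m_le: "m \<le> f x" if "x \<in> space M1" for x
    unfolding m_def using that lower[OF _ xy0(2)] by (intro cINF_lower bdd_belowI2)
  have m_ge: "- K - g y \<le> m" if "y \<in> space M2" for y
    unfolding m_def using that lower xy0 by (intro cINF_greatest) auto
  define f' g' where "f' x = min (f x - m) (2 * K)" and "g' y = min (g y + m) K" for x y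
  have f': "integrable M1 f'" and g': "integrable M2 g'"
    unfolding f'_def g'_def using f g by (auto intro!: integrable_min)
  show thesis
  proof (rule that[of f' g'])
    show "f' \<in> borel_measurable M1" "g' \<in> borel_measurable M2" using f' g' by auto
    show "\<bar>f' x\<bar> \<le> 2 * K" if "x \<in> space M1" for x
      using m_le[OF that] K0 by (simp add: f'_def)
    show "\<bar>g' y\<bar> \<le> 2 * K" if "y \<in> space M2" for y
      using m_ge[OF that] K0 by (auto simp: g'_def)
    show "c (x, y) \<le> f' x + g' y" if "x \<in> space M1" "y \<in> space M2" for x y
      using K[OF that] le[OF that] m_le[OF that(1)] m_ge[OF that(2)] K0
      by (auto simp: f'_def g'_def min_def)
    have "integral\<^sup>L M1 f' \<le> (\<integral>x. f x - m \<partial>M1)"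
      using f f' by (intro integral_mono) (auto simp: f'_def)
    moreover have "integral\<^sup>L M2 g' \<le> (\<integral>y. g y + m \<partial>M2)"
      using g g' by (intro integral_mono) (auto simp: g'_def)
    ultimately show "integral\<^sup>L M1 f' + integral\<^sup>L M2 g' \<le> integral\<^sup>L M1 f + integral\<^sup>L M2 g"
      using f g by (simp add: M1.prob_space M2.prob_space)
  qed
qed

lemma sum_dominated_bounded:
  assumes "c \<in> borel_measurable (M1 \<Otimes>\<^sub>M M2)"
    and "\<And>x y. x \<in> space M1 \<Longrightarrow> y \<in> space M2 \<Longrightarrow> \<bar>c (x, y)\<bar> \<le> (K::real)"
  shows "sum_dominated M1 M2 c"
  unfolding sum_dominated_def
proof (intro conjI exI ballI)
  show "integrable M1 (\<lambda>x. K)" "integrable M2 (\<lambda>y. 0)" by simp_all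
  show "\<bar>c (x, y)\<bar> \<le> K + 0" if "x \<in> space M1" "y \<in> space M2" for x y
    using assms(2)[OF that] by simp
qed (rule assms(1))

text \<open>Monotonicity is used twice: \<open>cs n \<le> c\<close> transfers the primal bound
  \<open>s\<close> to every \<open>cs n\<close>, and the increase in \<open>n\<close> makes the dual
  constraints nested. Convergence is demanded only over \<open>S\<close>, since the regularizations
  converge only there.\<close>

lemma sup_duality_increasing:
  assumes c: "c \<in> borel_measurable (M1 \<Otimes>\<^sub>M M2)" "\<And>n. cs n \<in> borel_measurable (M1 \<Otimes>\<^sub>M M2)"
    and K: "\<And>x y. x \<in> space M1 \<Longrightarrow> y \<in> space M2 \<Longrightarrow> \<bar>c (x, y)\<bar> \<le> (K::real)"
      "\<And>n x y. x \<in> space M1 \<Longrightarrow> y \<in> space M2 \<Longrightarrow> \<bar>cs n (x, y)\<bar> \<le> K"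
    and inc: "\<And>n x y. x \<in> space M1 \<Longrightarrow> y \<in> space M2 \<Longrightarrow> cs n (x, y) \<le> cs (Suc n) (x, y)"
    and le: "\<And>n x y. x \<in> space M1 \<Longrightarrow> y \<in> space M2 \<Longrightarrow> cs n (x, y) \<le> c (x, y)"
    and S: "AE x in M1. x \<in> S"
    and lim: "\<And>x y. x \<in> space M1 \<Longrightarrow> x \<in> S \<Longrightarrow> y \<in> space M2 \<Longrightarrow> (\<lambda>n. cs n (x, y)) \<longlonglongrightarrow> c (x, y)"
    and dual: "\<And>n. sup_duality M1 M2 (cs n)"
  shows "sup_duality M1 M2 c"
proof (rule sup_dualityI)
  fix s \<epsilon> :: real
  assume s: "\<And>P. P \<in> couplings M1 M2 \<Longrightarrow> integral\<^sup>L P c \<le> s" and \<epsilon>: "0 < \<epsilon>"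
  obtain x0 y0 where "x0 \<in> space M1" "y0 \<in> space M2"
    using M1.not_empty M2.not_empty by blast
  from K(1)[OF this] have K0: "0 \<le> K" by simp
  have s': "integral\<^sup>L P (cs n) \<le> s" if P: "P \<in> couplings M1 M2" for P n
  proof -
    have "integrable P c" "integrable P (cs n)"
      using P c K by (auto intro!: integrable_coupling sum_dominated_bounded[where K = K])
    then have "integral\<^sup>L P (cs n) \<le> integral\<^sup>L P c"
      using le by (intro integral_mono) (auto simp: couplingsD(3)[OF P])
    with s[OF P] show ?thesis by simp
  qed
  \<comment> \<open>The slack is positive, so that duality for \<open>cs n\<close> supplies such a
    pair; it decreases, so that the constraints are nested; and it tends to 0, so that the limit
    pair costs at most \<open>s\<close>.\<close>
  define C where "C n f g \<longleftrightarrow> f \<in> borel_measurable M1 \<and> g \<in> borel_measurable M2 \<and>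
      (\<forall>x\<in>space M1. \<bar>f x\<bar> \<le> 2 * K) \<and> (\<forall>y\<in>space M2. \<bar>g y\<bar> \<le> 2 * K) \<and>
      (\<forall>x\<in>space M1. \<forall>y\<in>space M2. cs n (x, y) \<le> f x + g y) \<and>
      integral\<^sup>L M1 f + integral\<^sup>L M2 g \<le> s + 1 / real (Suc n)" for n f g
  have C_int: "integrable M1 f" "integrable M2 g" if "C n f g" for n f g
    using that unfolding C_def
    by (auto intro!: M1.integrable_const_bound[where B = "2 * K"]
        M2.integrable_const_bound[where B = "2 * K"] AE_I2)
  obtain fs gs where C: "\<And>n. C n (fs n) (gs n)"
    and Cauchy: "AE x in M1. Cauchy (\<lambda>n. fs n x)" "AE y in M2. Cauchy (\<lambda>n. gs n y)"
  proof (rule nested_midpoint_convex_cauchy[of C "2 * K"])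
    show "\<exists>f g. C n f g" for n
    proof -
      obtain f g where fg: "integrable M1 f" "integrable M2 g"
        "\<And>x y. x \<in> space M1 \<Longrightarrow> y \<in> space M2 \<Longrightarrow> cs n (x, y) \<le> f x + g y"
        "integral\<^sup>L M1 f + integral\<^sup>L M2 g \<le> s + 1 / real (Suc n)"
        using sup_dualityE[OF dual[of n] s', of "1 / real (Suc n)"] by auto
      obtain f' g' where "f' \<in> borel_measurable M1" "g' \<in> borel_measurable M2"
        "\<And>x. x \<in> space M1 \<Longrightarrow> \<bar>f' x\<bar> \<le> 2 * K" "\<And>y. y \<in> space M2 \<Longrightarrow> \<bar>g' y\<bar> \<le> 2 * K"
        "\<And>x y. x \<in> space M1 \<Longrightarrow> y \<in> space M2 \<Longrightarrow> cs n (x, y) \<le> f' x + g' y"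
        "integral\<^sup>L M1 f' + integral\<^sup>L M2 g' \<le> integral\<^sup>L M1 f + integral\<^sup>L M2 g"
        using bounded_potentials[OF K(2) fg(1,2,3)] by blast
      with fg(4) have "C n f' g'" by (simp add: C_def)
      then show ?thesis by blast
    qed
    show "C n f g" if "C (Suc n) f g" for n f g
    proof -
      have "1 / real (Suc (Suc n)) \<le> 1 / real (Suc n)" by (simp add: field_simps)
      moreover have "cs n (x, y) \<le> f x + g y" if "x \<in> space M1" "y \<in> space M2" for x y
        using \<open>C (Suc n) f g\<close> that inc[OF that, of n] by (auto simp: C_def intro: order_trans)
      ultimately show ?thesis using that by (auto simp: C_def)
    qed
    show "C n (\<lambda>x. (f x + f' x) / 2) (\<lambda>y. (g y + g' y) / 2)" if C: "C n f g" "C n f' g'" for n f g f' g'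
      unfolding C_def
    proof (intro conjI ballI)
      show "(\<lambda>x. (f x + f' x) / 2) \<in> borel_measurable M1" "(\<lambda>y. (g y + g' y) / 2) \<in> borel_measurable M2"
        using C by (auto simp: C_def)
      show "\<bar>(f x + f' x) / 2\<bar> \<le> 2 * K" if "x \<in> space M1" for x
      proof -
        have "\<bar>f x\<bar> \<le> 2 * K" "\<bar>f' x\<bar> \<le> 2 * K" using C that by (auto simp: C_def)
        then show ?thesis by (simp add: abs_le_iff)
      qed
      show "\<bar>(g y + g' y) / 2\<bar> \<le> 2 * K" if "y \<in> space M2" for y
      proof -
        have "\<bar>g y\<bar> \<le> 2 * K" "\<bar>g' y\<bar> \<le> 2 * K" using C that by (auto simp: C_def)
        then show ?thesis by (simp add: abs_le_iff)
      qed
      show "cs n (x, y) \<le> (f x + f' x) / 2 + (g y + g' y) / 2" if "x \<in> space M1" "y \<in> space M2" for x y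
      proof -
        have "cs n (x, y) \<le> f x + g y" "cs n (x, y) \<le> f' x + g' y" using C that by (auto simp: C_def)
        then show ?thesis by (simp add: field_simps)
      qed
      show "(\<integral>x. (f x + f' x) / 2 \<partial>M1) + (\<integral>y. (g y + g' y) / 2 \<partial>M2) \<le> s + 1 / real (Suc n)"
      proof -
        have avg: "(p + p') / 2 + (q + q') / 2 \<le> t" if "p + q \<le> t" "p' + q' \<le> t"
          for p p' q q' t :: real
          using that by (simp add: field_simps)
        have "(\<integral>x. (f x + f' x) / 2 \<partial>M1) = (integral\<^sup>L M1 f + integral\<^sup>L M1 f') / 2"
          "(\<integral>y. (g y + g' y) / 2 \<partial>M2) = (integral\<^sup>L M2 g + integral\<^sup>L M2 g') / 2"
          using C_int[OF C(1)] C_int[OF C(2)] by simp_all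
        then show ?thesis using C unfolding C_def by (simp only:) (intro avg; blast)
      qed
    qed
  qed (auto simp: C_def)
  have fs: "fs n \<in> borel_measurable M1" "x \<in> space M1 \<Longrightarrow> \<bar>fs n x\<bar> \<le> 2 * K"
    and gs: "gs n \<in> borel_measurable M2" "y \<in> space M2 \<Longrightarrow> \<bar>gs n y\<bar> \<le> 2 * K" for n x y
    using C by (auto simp: C_def)
  \<comment> \<open>On an exceptional set a potential is set to \<open>3 * K\<close>. The other one
    is at least \<open>- 2 * K\<close>, so the sum is at least \<open>K\<close> and dominates
    \<open>c\<close> there.\<close>
  have b: "2 * K \<le> 3 * K" using K0 by simp
  \<comment> \<open>Membership in \<open>S\<close> is carried along so that the points off
    \<open>S\<close>, where \<open>cs n\<close> need not converge to \<open>c\<close>, fall into the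
    exceptional set \<open>N1\<close>.\<close>
  have "AE x in M1. Cauchy (\<lambda>n. fs n x) \<and> x \<in> S" using Cauchy(1) S by eventually_elim simp
  obtain F N1 where F: "integrable M1 F" "N1 \<subseteq> space M1" "\<And>x. x \<in> space M1 \<Longrightarrow> - (2 * K) \<le> F x"
    "\<And>x. x \<in> N1 \<Longrightarrow> F x = 3 * K"
    "\<And>x. x \<in> space M1 - N1 \<Longrightarrow> x \<in> S \<and> (\<lambda>n. fs n x) \<longlonglongrightarrow> F x"
    "(\<lambda>n. integral\<^sup>L M1 (fs n)) \<longlonglongrightarrow> integral\<^sup>L M1 F"
  proof (rule M1.bounded_AE_limit_integral[OF fs b
        \<open>AE x in M1. Cauchy (\<lambda>n. fs n x) \<and> x \<in> S\<close>], goal_cases)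
    case 1
    then show ?case by simp
  next
    case 2
    from 2(2-) show ?case by (rule that)
  qed
  have "AE y in M2. Cauchy (\<lambda>n. gs n y) \<and> y \<in> space M2"
    using Cauchy(2) AE_space by eventually_elim simp
  obtain G N2 where G: "integrable M2 G" "N2 \<subseteq> space M2" "\<And>y. y \<in> space M2 \<Longrightarrow> - (2 * K) \<le> G y"
    "\<And>y. y \<in> N2 \<Longrightarrow> G y = 3 * K"
    "\<And>y. y \<in> space M2 - N2 \<Longrightarrow> y \<in> space M2 \<and> (\<lambda>n. gs n y) \<longlonglongrightarrow> G y"
    "(\<lambda>n. integral\<^sup>L M2 (gs n)) \<longlonglongrightarrow> integral\<^sup>L M2 G"
  proof (rule M2.bounded_AE_limit_integral[OF gs b
        \<open>AE y in M2. Cauchy (\<lambda>n. gs n y) \<and> y \<in> space M2\<close>], goal_cases)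
    case 1
    then show ?case by simp
  next
    case 2
    from 2(2-) show ?case by (rule that)
  qed
  have "c (x, y) \<le> F x + G y" if xy: "x \<in> space M1" "y \<in> space M2" for x y
  proof (cases "x \<in> N1 \<or> y \<in> N2")
    case True
    then show ?thesis
      using K(1)[OF xy] F(3)[OF xy(1)] G(3)[OF xy(2)] F(4)[of x] G(4)[of y] by force
  next
    case False
    have "(\<lambda>n. fs n x + gs n y) \<longlonglongrightarrow> F x + G y"
      using False xy F(5)[of x] G(5)[of y] by (intro tendsto_add) auto
    moreover have "(\<lambda>n. cs n (x, y)) \<longlonglongrightarrow> c (x, y)"
      using False xy F(5)[of x] by (intro lim) auto
    ultimately show ?thesis
      using C xy by (intro LIMSEQ_le) (auto simp: C_def)
  qed
  moreover have "integral\<^sup>L M1 F + integral\<^sup>L M2 G \<le> s + 0"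
  proof (rule LIMSEQ_le)
    show "(\<lambda>n. integral\<^sup>L M1 (fs n) + integral\<^sup>L M2 (gs n)) \<longlonglongrightarrow> integral\<^sup>L M1 F + integral\<^sup>L M2 G"
      by (intro tendsto_add F(6) G(6))
    show "(\<lambda>n. s + 1 / real (Suc n)) \<longlonglongrightarrow> s + 0"
      using LIMSEQ_inverse_real_of_nat by (intro tendsto_add tendsto_const) (simp add: inverse_eq_divide)
    show "\<exists>k. \<forall>n\<ge>k. integral\<^sup>L M1 (fs n) + integral\<^sup>L M2 (gs n) \<le> s + 1 / real (Suc n)"
      using C by (auto simp: C_def)
  qed
  ultimately show "\<exists>f g. integrable M1 f \<and> integrable M2 g \<and>
      (\<forall>x\<in>space M1. \<forall>y\<in>space M2. c (x, y) \<le> f x + g y) \<and>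
      integral\<^sup>L M1 f + integral\<^sup>L M2 g \<le> s + \<epsilon>"
    using F(1) G(1) \<epsilon> by (intro exI[of _ F] exI[of _ G]) auto
qed

end

subsection \<open>Costs that are continuous in the first variable\<close>

text \<open>The infimum is taken over the countable dense set \<open>D\<close> for the sake of
  measurability; continuity on \<open>S\<close> compensates for the missing points. The lower bound
  \<open>- K\<close> as value off \<open>S\<close> keeps the sequence monotone there.\<close>

lemma lipschitz_regularization:
  fixes c :: "'a::metric_space \<times> 'b \<Rightarrow> real"
  assumes M: "sets M = sets borel" and S: "S \<in> sets M"
    and D: "countable D" "D \<noteq> {}" "D \<subseteq> S" "S \<subseteq> closure D"
    and K: "\<And>x y. x \<in> S \<Longrightarrow> y \<in> space N \<Longrightarrow> \<bar>c (x, y)\<bar> \<le> K"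
    and cont: "\<And>y. y \<in> space N \<Longrightarrow> continuous_on S (\<lambda>x. c (x, y))"
    and meas: "\<And>x. x \<in> S \<Longrightarrow> (\<lambda>y. c (x, y)) \<in> borel_measurable N"
  obtains cs :: "nat \<Rightarrow> 'a \<times> 'b \<Rightarrow> real"
  where "\<And>n. cs n \<in> borel_measurable (M \<Otimes>\<^sub>M N)"
    and "\<And>n x y. x \<notin> S \<Longrightarrow> cs n (x, y) = - K"
    and "\<And>n x y. x \<in> S \<Longrightarrow> y \<in> space N \<Longrightarrow> - K \<le> cs n (x, y) \<and> cs n (x, y) \<le> c (x, y)"
    and "\<And>n x y. x \<in> S \<Longrightarrow> y \<in> space N \<Longrightarrow> cs n (x, y) \<le> cs (Suc n) (x, y)"
    and "\<And>x y. x \<in> S \<Longrightarrow> y \<in> space N \<Longrightarrow> (\<lambda>n. cs n (x, y)) \<longlonglongrightarrow> c (x, y)"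
    and "\<And>n x x' y. x \<in> S \<Longrightarrow> x' \<in> S \<Longrightarrow> y \<in> space N \<Longrightarrow>
      \<bar>cs n (x, y) - cs n (x', y)\<bar> \<le> real n * dist x x'"
proof -
  define p where "p n x y d = c (d, y) + real n * dist x d" for n :: nat and x y d
  define cs where "cs n z = (if fst z \<in> S then INF d\<in>D. p n (fst z) (snd z) d else - K)" for n z
  have p_ge: "- K \<le> p n x y d" if "y \<in> space N" "d \<in> D" for n x y d
  proof -
    have "\<bar>c (d, y)\<bar> \<le> K" using that D(3) by (intro K) auto
    moreover have "0 \<le> real n * dist x d" by simp
    ultimately show ?thesis unfolding p_def by linarith
  qed
  have cs_eq: "cs n (x, y) = (INF d\<in>D. p n x y d)" if "x \<in> S" for n x y
    using that by (simp add: cs_def)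
  have bdd: "bdd_below (p n x y ` D)" if "y \<in> space N" for n x y
    using p_ge[OF that] by (rule bdd_belowI2)
  have cs_le: "cs n (x, y) \<le> p n x y d" if "x \<in> S" "y \<in> space N" "d \<in> D" for n x y d
    unfolding cs_eq[OF that(1)] using that by (intro cINF_lower bdd)
  have cs_ge: "m \<le> cs n (x, y)" if "x \<in> S" "\<And>d. d \<in> D \<Longrightarrow> m \<le> p n x y d" for m n x y
    unfolding cs_eq[OF that(1)] using that D(2) by (intro cINF_greatest)
  have near: "\<exists>d\<in>D. dist x d < \<delta> \<and> \<bar>c (d, y) - c (x, y)\<bar> < e"
    if xy: "x \<in> S" "y \<in> space N" and pos: "0 < \<delta>" "0 < e" for x y \<delta> e
  proof -
    obtain \<eta> where \<eta>: "0 < \<eta>" "\<And>x'. x' \<in> S \<Longrightarrow> dist x' x < \<eta> \<Longrightarrow> \<bar>c (x', y) - c (x, y)\<bar> < e"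
      using cont[OF xy(2)] xy(1) pos(2) unfolding continuous_on_iff dist_real_def by blast
    obtain d where "d \<in> D" "dist d x < min \<delta> \<eta>"
      using D(4) xy(1) pos(1) \<eta>(1) by (meson closure_approachable min_less_iff_conj subsetD)
    with \<eta>(2)[of d] D(3) show ?thesis by (intro bexI[of _ d]) (auto simp: dist_commute)
  qed
  have cs_le_c: "cs n (x, y) \<le> c (x, y)" if x: "x \<in> S" "y \<in> space N" for n x y
  proof (rule field_le_epsilon)
    fix e :: real assume e: "0 < e"
    \<comment> \<open>The point \<open>x\<close> itself may not lie in \<open>D\<close>. A nearby
      \<open>d\<close> costs less than \<open>h\<close> through \<open>c\<close> and at most
      \<open>real n * h\<close> through the penalty, together less than \<open>e\<close>.\<close>
    define h where "h = e / (1 + real n)"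
    have h: "0 < h" "h + real n * h = e"
      using e by (auto simp: h_def field_simps add_divide_distrib[symmetric])
    obtain d where d: "d \<in> D" "dist x d < h" "\<bar>c (d, y) - c (x, y)\<bar> < h"
      using near[OF x h(1) h(1)] by blast
    have "real n * dist x d \<le> real n * h" using d(2) by (intro mult_left_mono) auto
    with d h cs_le[OF x d(1), of n] show "cs n (x, y) \<le> c (x, y) + e"
      unfolding p_def by linarith
  qed
  have cs_lip: "cs n (x, y) \<le> cs n (x', y) + real n * dist x x'"
    if "x \<in> S" "x' \<in> S" "y \<in> space N" for n x x' y
  proof -
    have "cs n (x, y) - real n * dist x x' \<le> p n x' y d" if d: "d \<in> D" for d
    proof -
      have "real n * dist x d \<le> real n * (dist x x' + dist x' d)"
        by (intro mult_left_mono dist_triangle) simp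
      then show ?thesis
        using cs_le[OF \<open>x \<in> S\<close> \<open>y \<in> space N\<close> d, of n] unfolding p_def by (simp add: algebra_simps)
    qed
    from cs_ge[OF that(2) this] show ?thesis by simp
  qed
  show thesis
  proof (rule that[of cs])
    show "cs n \<in> borel_measurable (M \<Otimes>\<^sub>M N)" for n
      unfolding cs_def
    proof (intro measurable_If borel_measurable_cINF_real D(1) borel_measurable_const)
      fix d assume d: "d \<in> D"
      have m[measurable]: "(\<lambda>y. c (d, y)) \<in> borel_measurable N"
        using meas d D(3) by auto
      have [measurable]: "(\<lambda>x. dist x d) \<in> borel_measurable M"
        by (simp add: measurable_cong_sets[OF M refl] borel_measurable_continuous_onI continuous_on_dist)
      show "(\<lambda>z. p n (fst z) (snd z) d) \<in> borel_measurable (M \<Otimes>\<^sub>M N)"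
        unfolding p_def by measurable
    next
      show "{z \<in> space (M \<Otimes>\<^sub>M N). fst z \<in> S} \<in> sets (M \<Otimes>\<^sub>M N)"
        using S by measurable
    qed
    show "cs n (x, y) = - K" if "x \<notin> S" for n x y using that by (simp add: cs_def)
    show "- K \<le> cs n (x, y) \<and> cs n (x, y) \<le> c (x, y)" if "x \<in> S" "y \<in> space N" for n x y
      using cs_ge[OF that(1) p_ge[OF that(2)]] cs_le_c[OF that] by blast
    show mono: "cs n (x, y) \<le> cs (Suc n) (x, y)" if "x \<in> S" "y \<in> space N" for n x y
    proof (rule cs_ge[OF that(1)])
      fix d assume "d \<in> D"
      have "p n x y d \<le> p (Suc n) x y d" by (simp add: p_def algebra_simps)
      with cs_le[OF that \<open>d \<in> D\<close>, of n] show "cs n (x, y) \<le> p (Suc n) x y d" by simp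
    qed
    show "\<bar>cs n (x, y) - cs n (x', y)\<bar> \<le> real n * dist x x'"
      if "x \<in> S" "x' \<in> S" "y \<in> space N" for n x x' y
      using cs_lip[OF that, of n] cs_lip[OF that(2,1,3), of n]
      by (simp add: abs_le_iff dist_commute)
    show "(\<lambda>n. cs n (x, y)) \<longlonglongrightarrow> c (x, y)" if x: "x \<in> S" "y \<in> space N" for x y
    proof (rule LIMSEQ_I)
      fix e :: real assume e: "0 < e"
      obtain \<eta> where \<eta>: "0 < \<eta>" "\<And>x'. x' \<in> S \<Longrightarrow> dist x' x < \<eta> \<Longrightarrow> \<bar>c (x', y) - c (x, y)\<bar> < e / 2"
        using cont[OF x(2)] x(1) half_gt_zero[OF e] unfolding continuous_on_iff dist_real_def by blast
      \<comment> \<open>From \<open>n0\<close> on, the penalty at distance at least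
        \<open>\<eta>\<close> exceeds \<open>2 * K\<close>, the largest possible oscillation of
        \<open>c\<close>, so only points near \<open>x\<close> can lower the infimum
        appreciably.\<close>
      obtain n0 :: nat where n0: "2 * K / \<eta> < n0" using reals_Archimedean2 by blast
      have "norm (cs n (x, y) - c (x, y)) < e" if n: "n0 \<le> n" for n
      proof -
        have "c (x, y) - e / 2 \<le> cs n (x, y)"
        proof (rule cs_ge[OF x(1)])
          fix d assume d: "d \<in> D"
          show "c (x, y) - e / 2 \<le> p n x y d"
          proof (cases "dist x d < \<eta>")
            case True
            then have "\<bar>c (d, y) - c (x, y)\<bar> < e / 2"
              using d D(3) by (intro \<eta>) (auto simp: dist_commute)
            moreover have "0 \<le> real n * dist x d" by simp
            ultimately show ?thesis unfolding p_def by linarith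
          next
            case False
            have "2 * K \<le> real n0 * \<eta>" using n0 \<eta>(1) by (simp add: field_simps)
            also have "\<dots> \<le> real n * dist x d" using False n \<eta>(1) by (intro mult_mono) auto
            finally have "2 * K \<le> real n * dist x d" .
            moreover have "\<bar>c (d, y)\<bar> \<le> K" "\<bar>c (x, y)\<bar> \<le> K" using d D(3) x by (auto intro!: K)
            moreover have "0 < e / 2" using e by simp
            ultimately show ?thesis unfolding p_def by linarith
          qed
        qed
        moreover have "e / 2 < e" using e by simp
        ultimately show ?thesis using cs_le_c[OF x, of n] by (simp add: abs_less_iff)
      qed
      then show "\<exists>n0. \<forall>n\<ge>n0. norm (cs n (x, y) - c (x, y)) < e" by blast
    qed
  qed
qed

text \<open>The step cost reads off a centre \<open>d i\<close> close to \<open>x\<close> and the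
  value of \<open>k (d i, y)\<close> rounded to a multiple of \<open>e\<close>. The label of
  \<open>y\<close> is the whole vector of rounded values at the centres, so measurability in
  \<open>y\<close> is enough.\<close>

lemma sup_duality_lipschitz:
  fixes M :: "'a::metric_space measure" and N :: "'b measure" and k :: "'a \<times> 'b \<Rightarrow> real"
  assumes "pair_prob_space M N" and M: "sets M = sets borel"
    and S: "S \<in> sets M" "AE x in M. x \<in> S"
    and D: "countable D" "D \<noteq> {}" "D \<subseteq> S" "S \<subseteq> closure D"
    and k: "k \<in> borel_measurable (M \<Otimes>\<^sub>M N)"
    and K: "\<And>x y. x \<in> space M \<Longrightarrow> y \<in> space N \<Longrightarrow> \<bar>k (x, y)\<bar> \<le> K"
    and L: "0 \<le> L" "\<And>x x' y. x \<in> S \<Longrightarrow> x' \<in> S \<Longrightarrow> y \<in> space N \<Longrightarrow> \<bar>k (x, y) - k (x', y)\<bar> \<le> L * dist x x'"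
  shows "sup_duality M N k"
proof -
  interpret pair_prob_space M N by fact
  note [measurable] = S(1) k
  have SM: "S \<subseteq> space M" using S(1) by (rule sets.sets_into_space)
  have K0: "0 \<le> K" using K M1.not_empty M2.not_empty abs_ge_zero order_trans by blast
  have [measurable]: "(\<lambda>x. dist x d) \<in> borel_measurable M" for d
    by (simp add: measurable_cong_sets[OF M refl] borel_measurable_continuous_onI continuous_on_dist)
  show ?thesis
  proof (rule sup_duality_approx)
    show "sum_dominated M N k" using k K by (rule sum_dominated_bounded)
    fix \<delta> :: real assume \<delta>: "0 < \<delta>"
    \<comment> \<open>The budget: \<open>L * e\<close> for moving \<open>x\<close> to its centre,
      \<open>e\<close> for rounding, and \<open>K * e\<close> for the points of \<open>M\<close>
      left uncovered.\<close>
    define e where "e = \<delta> / (L + 1 + K)"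
    have e: "0 < e" "(L + 1 + K) * e = \<delta>" using \<delta> K0 L(1) by (auto simp: e_def)
    define d where "d = from_nat_into D"
    have dD: "d i \<in> D" for i unfolding d_def using D(2) by (rule from_nat_into)
    then have dS: "d i \<in> S" for i using D(3) by blast
    have cover: "\<exists>i. dist x (d i) < e" if x: "x \<in> S" for x
    proof -
      obtain x' where "x' \<in> D" "dist x' x < e"
        using D(4) x e(1) by (meson closure_approachable subsetD)
      then show ?thesis
        using from_nat_into_surj[OF D(1)] by (metis d_def dist_commute)
    qed
    define T where "T n = {x\<in>space M. x \<in> S \<and> (\<exists>i<n. dist x (d i) < e)}" for n :: nat
    have T_sets[measurable]: "T n \<in> sets M" for n unfolding T_def by measurable
    \<comment> \<open>Continuity of the measure from below replaces total boundedness: finitely many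
      balls around points of \<open>D\<close> cover all but mass \<open>e\<close>.\<close>
    have "(\<lambda>n. measure M (T n)) \<longlonglongrightarrow> measure M (\<Union>n. T n)"
      by (intro M1.finite_Lim_measure_incseq incseq_SucI) (auto simp: T_def less_Suc_eq)
    also have "(\<Union>n. T n) = S" using cover SM by (fastforce simp: T_def)
    also have "measure M S = 1" using S by (simp add: M1.prob_eq_1)
    finally obtain n where "\<bar>measure M (T n) - 1\<bar> < e"
      using LIMSEQ_D[of _ 1 e] e(1) by (metis order_refl real_norm_def)
    moreover have "measure M (space M - T n) = 1 - measure M (T n)"
      by (simp add: M1.prob_compl)
    ultimately have small: "measure M (space M - T n) \<le> e" by linarith
    \<comment> \<open>The extra label \<open>n\<close> marks the uncovered points; the step cost is
      0 there, and the error is at most \<open>K\<close>.\<close>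
    define a where "a x = (if x \<in> T n then LEAST i. dist x (d i) < e else n)" for x
    have a_T: "a x < n \<and> dist x (d (a x)) < e" if x: "x \<in> T n" for x
    proof -
      obtain i where i: "i < n" "dist x (d i) < e" using x by (auto simp: T_def)
      show ?thesis
        using LeastI[of "\<lambda>i. dist x (d i) < e", OF i(2)] Least_le[of "\<lambda>i. dist x (d i) < e", OF i(2)]
          i(1) x by (simp add: a_def)
    qed
    have a_UNIV: "a \<in> M \<rightarrow>\<^sub>M count_space UNIV" unfolding a_def by measurable
    have a: "a \<in> M \<rightarrow>\<^sub>M count_space {..n}"
      unfolding measurable_count_space_eq_countable[OF countable_finite[OF finite_atMost]]
    proof (intro conjI ballI)
      have "a x \<le> n" for x
      proof (cases "x \<in> T n")
        case False
        then show ?thesis by (simp add: a_def)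
      qed (use a_T in \<open>auto intro: less_imp_le\<close>)
      then show "a \<in> space M \<rightarrow> {..n}" by simp
      show "a -` {i} \<inter> space M \<in> sets M" for i
        by (rule measurable_sets[OF a_UNIV]) simp
    qed
    \<comment> \<open>Floors of numbers of modulus at most \<open>K / e\<close> lie in
      \<open>{-m..m}\<close>, so only finitely many vectors occur as labels of
      \<open>y\<close>.\<close>
    define m where "m = \<lceil>K / e\<rceil> + 1"
    define J where "J = PiE {..<n} (\<lambda>_. {-m..m})"
    define b where "b y = restrict (\<lambda>i. \<lfloor>k (d i, y) / e\<rfloor>) {..<n}" for y
    have k_sec[measurable]: "(\<lambda>y. k (d i, y)) \<in> borel_measurable N" for i
      using dS[of i] SM by (intro measurable_Pair2[OF k]) auto
    have b_in: "b y \<in> J" if "y \<in> space N" for y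
    proof -
      have "\<lfloor>k (d i, y) / e\<rfloor> \<in> {-m..m}" for i
      proof -
        have "\<bar>k (d i, y)\<bar> \<le> K" using dS[of i] SM that by (intro K) auto
        then have "\<bar>k (d i, y) / e\<bar> \<le> K / e"
          using e(1) by (simp add: abs_divide divide_right_mono)
        then have "- (K / e) \<le> k (d i, y) / e" "k (d i, y) / e \<le> K / e" by linarith+
        then show ?thesis unfolding m_def by simp linarith
      qed
      then show ?thesis by (auto simp: b_def J_def)
    qed
    have J: "finite J" unfolding J_def by (intro finite_PiE) auto
    have b: "b \<in> N \<rightarrow>\<^sub>M count_space J"
      unfolding measurable_count_space_eq_countable[OF countable_finite[OF J]]
    proof (intro conjI ballI)
      show "b \<in> space N \<rightarrow> J" using b_in by blast
      fix f assume f: "f \<in> J"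
      have "b -` {f} \<inter> space N = {y\<in>space N. \<forall>i<n. \<lfloor>k (d i, y) / e\<rfloor> = f i}"
        using f by (auto simp: b_def J_def fun_eq_iff restrict_def PiE_def extensional_def)
      also have "\<dots> \<in> sets N" by measurable
      finally show "b -` {f} \<inter> space N \<in> sets N" .
    qed
    define h where "h i f = (if i < n then e * of_int (f i) else 0)" for i and f :: "nat \<Rightarrow> int"
    define F where "F x = (L + 1) * e + K * indicator (space M - T n) x" for x
    have "integrable M (indicator (space M - T n) :: 'a \<Rightarrow> real)"
      by (intro integrable_real_indicator) (auto simp: less_top[symmetric])
    then have F_parts: "integrable M (\<lambda>x. (L + 1) * e)"
        "integrable M (\<lambda>x. K * indicator (space M - T n) x)"
      by (intro M1.integrable_const integrable_mult_right; assumption)+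
    then have "integrable M F"
      unfolding F_def by (rule Bochner_Integration.integrable_add)
    moreover have "integral\<^sup>L M F + integral\<^sup>L N (\<lambda>y. 0) \<le> \<delta>"
    proof -
      have "integral\<^sup>L M F = (L + 1) * e + K * measure M (space M - T n)"
        unfolding F_def Bochner_Integration.integral_add[OF F_parts]
        by (simp add: M1.prob_space Int_absorb1)
      also have "\<dots> \<le> (L + 1) * e + K * e"
        using small K0 by (intro add_left_mono mult_left_mono)
      also have "\<dots> = \<delta>" using e(2) by (simp add: algebra_simps)
      finally show ?thesis by simp
    qed
    moreover have "\<bar>k (x, y) - h (a x) (b y)\<bar> \<le> F x + 0" if xy: "x \<in> space M" "y \<in> space N" for x y
    proof (cases "x \<in> T n")
      case True
      let ?i = "a x"
      have i: "?i < n" "dist x (d ?i) < e" using a_T[OF True] by auto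
      have "\<bar>k (x, y) - k (d ?i, y)\<bar> \<le> L * dist x (d ?i)"
        using True dS xy by (intro L) (auto simp: T_def)
      also have "\<dots> \<le> L * e" using i L(1) by (intro mult_left_mono) auto
      finally have 1: "\<bar>k (x, y) - k (d ?i, y)\<bar> \<le> L * e" .
      have "\<bar>k (d ?i, y) / e - of_int \<lfloor>k (d ?i, y) / e\<rfloor>\<bar> \<le> 1" by linarith
      then have "\<bar>k (d ?i, y) / e - of_int \<lfloor>k (d ?i, y) / e\<rfloor>\<bar> * e \<le> 1 * e"
        using e(1) by (intro mult_right_mono) auto
      also have "\<bar>k (d ?i, y) / e - of_int \<lfloor>k (d ?i, y) / e\<rfloor>\<bar> * e
          = \<bar>(k (d ?i, y) / e - of_int \<lfloor>k (d ?i, y) / e\<rfloor>) * e\<bar>"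
        using e(1) by (simp add: abs_mult)
      also have "(k (d ?i, y) / e - of_int \<lfloor>k (d ?i, y) / e\<rfloor>) * e = k (d ?i, y) - h (a x) (b y)"
        using e(1) i(1) by (simp add: h_def b_def algebra_simps)
      finally have 2: "\<bar>k (d ?i, y) - h (a x) (b y)\<bar> \<le> e" by simp
      have "F x = L * e + e" using True by (simp add: F_def algebra_simps)
      with 1 2 show ?thesis by linarith
    next
      case False
      then have "h (a x) (b y) = 0" "F x = (L + 1) * e + K"
        using xy by (simp_all add: h_def a_def F_def)
      moreover have "0 \<le> (L + 1) * e" using L(1) e(1) by simp
      ultimately show ?thesis using K[OF xy] by simp
    qed
    ultimately show "\<exists>c' F G. sum_dominated M N c' \<and> sup_duality M N c' \<and>
        integrable M F \<and> integrable N G \<and> integral\<^sup>L M F + integral\<^sup>L N G \<le> \<delta> \<and>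
        (\<forall>x\<in>space M. \<forall>y\<in>space N. \<bar>k (x, y) - c' (x, y)\<bar> \<le> F x + G y)"
      using sum_dominated_step_function[OF finite_atMost a J b, of h]
        sup_duality_step_function[OF finite_atMost a J b, of h]
      by (intro exI[of _ "\<lambda>z. h (a (fst z)) (b (snd z))"] exI[of _ F] exI[of _ "\<lambda>y. 0"]) simp
  qed
qed

text \<open>The value \<open>- K\<close> off \<open>S\<close> keeps the regularizations below
  \<open>c\<close> on the whole space, while convergence may fail off \<open>S\<close>, a null set
  in the first factor.\<close>

lemma sup_duality_bounded_continuous:
  fixes M :: "'a::metric_space measure" and N :: "'b measure" and c :: "'a \<times> 'b \<Rightarrow> real"
  assumes MN: "pair_prob_space M N" and M: "sets M = sets borel"
    and S: "S \<in> sets M" "AE x in M. x \<in> S"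
    and D: "countable D" "D \<noteq> {}" "D \<subseteq> S" "S \<subseteq> closure D"
    and c: "c \<in> borel_measurable (M \<Otimes>\<^sub>M N)"
    and K: "\<And>x y. x \<in> space M \<Longrightarrow> y \<in> space N \<Longrightarrow> \<bar>c (x, y)\<bar> \<le> K"
    and cont: "\<And>y. y \<in> space N \<Longrightarrow> continuous_on S (\<lambda>x. c (x, y))"
  shows "sup_duality M N c"
proof -
  interpret pair_prob_space M N by fact
  have SM: "S \<subseteq> space M" using S(1) by (rule sets.sets_into_space)
  have K0: "0 \<le> K" using K M1.not_empty M2.not_empty abs_ge_zero order_trans by blast
  have sections: "(\<lambda>y. c (x, y)) \<in> borel_measurable N" if "x \<in> S" for x
    using that SM by (intro measurable_Pair2[OF c]) auto
  obtain cs :: "nat \<Rightarrow> 'a \<times> 'b \<Rightarrow> real"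
    where cs: "\<And>n. cs n \<in> borel_measurable (M \<Otimes>\<^sub>M N)"
    "\<And>n x y. x \<notin> S \<Longrightarrow> cs n (x, y) = - K"
    "\<And>n x y. x \<in> S \<Longrightarrow> y \<in> space N \<Longrightarrow> - K \<le> cs n (x, y) \<and> cs n (x, y) \<le> c (x, y)"
    "\<And>n x y. x \<in> S \<Longrightarrow> y \<in> space N \<Longrightarrow> cs n (x, y) \<le> cs (Suc n) (x, y)"
    "\<And>x y. x \<in> S \<Longrightarrow> y \<in> space N \<Longrightarrow> (\<lambda>n. cs n (x, y)) \<longlonglongrightarrow> c (x, y)"
    "\<And>n x x' y. x \<in> S \<Longrightarrow> x' \<in> S \<Longrightarrow> y \<in> space N \<Longrightarrow>
      \<bar>cs n (x, y) - cs n (x', y)\<bar> \<le> real n * dist x x'"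
  proof (rule lipschitz_regularization[where N = N and c = c and K = K, OF M S(1) D], goal_cases)
    case 1
    then show ?case using K SM by blast
  next
    case 2
    then show ?case using cont by blast
  next
    case 3
    from 3(2) show ?case by (rule sections)
  next
    case 4
    from 4(2-) show ?case by (rule 4(1))
  qed
  have le: "cs n (x, y) \<le> c (x, y)" if xy: "x \<in> space M" "y \<in> space N" for n x y
    using cs(2)[of x n y] cs(3)[OF _ xy(2), of x n] K[OF xy] by (cases "x \<in> S") (auto simp: abs_le_iff)
  have csK: "\<bar>cs n (x, y)\<bar> \<le> K" if xy: "x \<in> space M" "y \<in> space N" for n x y
    using cs(2)[of x n y] cs(3)[OF _ xy(2), of x n] K[OF xy] le[OF xy, of n] K0
    by (cases "x \<in> S") (auto simp: abs_le_iff)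
  show ?thesis
  proof (rule sup_duality_increasing[OF c cs(1) K csK _ le S(2)])
    show "cs n (x, y) \<le> cs (Suc n) (x, y)" if "x \<in> space M" "y \<in> space N" for n x y
      using cs(2)[of x _ y] cs(4)[OF _ that(2)] by (cases "x \<in> S") auto
    show "(\<lambda>n. cs n (x, y)) \<longlonglongrightarrow> c (x, y)" if "x \<in> S" "y \<in> space N" for x y
      using that by (rule cs(5))
    show "sup_duality M N (cs n)" for n
      using MN M S D cs(1) csK of_nat_0_le_iff cs(6) by (rule sup_duality_lipschitz)
  qed
qed

subsection \<open>Truncation and the case of unbounded costs\<close>

lemma clamp_tendsto: "(\<lambda>n. max (- real n) (min (real n) t)) \<longlonglongrightarrow> t"
proof (rule tendsto_eventually)
  obtain n0 :: nat where n0: "\<bar>t\<bar> \<le> real n0" using real_arch_simple by blast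
  have "max (- real n) (min (real n) t) = t" if "n0 \<le> n" for n
  proof -
    have "\<bar>t\<bar> \<le> real n" using n0 that by linarith
    then show ?thesis by (simp add: abs_le_iff max_def min_def)
  qed
  then show "\<forall>\<^sub>F n in sequentially. max (- real n) (min (real n) t) = t"
    by (auto simp: eventually_sequentially)
qed

text \<open>Over \<open>S\<close> a bounded cost is the pointwise limit of its jointly measurable
  regularizations; a general one is first clamped to a bounded interval.\<close>

lemma measurable_caratheodory:
  fixes c :: "'a::metric_space \<times> 'b \<Rightarrow> real"
  assumes M: "sets M = sets borel" and S: "S \<in> sets M"
    and D: "countable D" "D \<noteq> {}" "D \<subseteq> S" "S \<subseteq> closure D"
    and cont: "\<And>y. y \<in> space N \<Longrightarrow> continuous_on S (\<lambda>x. c (x, y))"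
    and meas: "\<And>x. x \<in> S \<Longrightarrow> (\<lambda>y. c (x, y)) \<in> borel_measurable N"
  shows "(\<lambda>z. if fst z \<in> S then c z else 0) \<in> borel_measurable (M \<Otimes>\<^sub>M N)"
proof -
  define k where "k n z = max (- real n) (min (real n) (c z))" for n :: nat and z
  have SP[measurable]: "Measurable.pred (M \<Otimes>\<^sub>M N) (\<lambda>z. fst z \<in> S)"
    using S by measurable
  \<comment> \<open>The regularizations of \<open>k n\<close> equal \<open>- real n\<close> off
    \<open>S\<close>, which dictates this default value. It is replaced by 0 before the limit in
    \<open>n\<close> is taken.\<close>
  have k: "(\<lambda>z. if fst z \<in> S then k n z else - real n) \<in> borel_measurable (M \<Otimes>\<^sub>M N)" for n
  proof (rule lipschitz_regularization[where N = N and c = "k n" and K = "real n", OF M S D],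
      goal_cases)
    case (1 x y)
    then show ?case by (auto simp: k_def)
  next
    case (2 y)
    then show ?case unfolding k_def using cont by (intro continuous_intros) auto
  next
    case (3 x)
    then show ?case unfolding k_def using meas[of x] by measurable
  next
    case (4 cs)
    show ?case
    proof (rule borel_measurable_LIMSEQ_real[where u = cs])
      fix z assume "z \<in> space (M \<Otimes>\<^sub>M N)"
      then show "(\<lambda>i. cs i z) \<longlonglongrightarrow> (if fst z \<in> S then k n z else - real n)"
        using 4(2,5) by (cases z) (auto simp: space_pair_measure)
    qed (rule 4(1))
  qed
  show ?thesis
  proof (rule borel_measurable_LIMSEQ_real[where u = "\<lambda>n z. if fst z \<in> S then k n z else 0"])
    show "(\<lambda>n. if fst z \<in> S then k n z else 0) \<longlonglongrightarrow> (if fst z \<in> S then c z else 0)" for z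
      by (simp add: k_def clamp_tendsto)
    have "(\<lambda>z. if fst z \<in> S then (if fst z \<in> S then k n z else - real n) else 0)
        \<in> borel_measurable (M \<Otimes>\<^sub>M N)" for n
      using k[of n] by measurable
    then show "(\<lambda>z. if fst z \<in> S then k n z else 0) \<in> borel_measurable (M \<Otimes>\<^sub>M N)" for n
      by (simp cong: if_cong)
  qed
qed

lemma integral_tail_tendsto_0:
  fixes f :: "'a \<Rightarrow> real"
  assumes f: "integrable M f"
  shows "(\<lambda>n. \<integral>x. max 0 (\<bar>f x\<bar> - real n) \<partial>M) \<longlonglongrightarrow> 0"
proof -
  have "(\<lambda>n. \<integral>x. max 0 (\<bar>f x\<bar> - real n) \<partial>M) \<longlonglongrightarrow> (\<integral>x. 0 \<partial>M)"
  proof (rule integral_dominated_convergence[where w = "\<lambda>x. \<bar>f x\<bar>"])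
    show "AE x in M. (\<lambda>n. max 0 (\<bar>f x\<bar> - real n)) \<longlonglongrightarrow> 0"
    proof (intro AE_I2 tendsto_eventually)
      fix x
      obtain n0 :: nat where n0: "\<bar>f x\<bar> \<le> real n0" using real_arch_simple by blast
      have "max 0 (\<bar>f x\<bar> - real n) = 0" if "n0 \<le> n" for n
        using n0 that by (intro max_absorb1) linarith
      then show "\<forall>\<^sub>F n in sequentially. max 0 (\<bar>f x\<bar> - real n) = 0"
        by (auto simp: eventually_sequentially)
    qed
    show "integrable M (\<lambda>x. \<bar>f x\<bar>)" using f by simp
    show "(\<lambda>x. max 0 (\<bar>f x\<bar> - real n)) \<in> borel_measurable M" for n using f by measurable
  qed auto
  then show ?thesis by simp
qed

lemma sup_duality_continuous:
  fixes M :: "'a::metric_space measure" and N :: "'b measure" and c :: "'a \<times> 'b \<Rightarrow> real"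
  assumes MN: "pair_prob_space M N" and M: "sets M = sets borel"
    and S: "S \<in> sets M" "AE x in M. x \<in> S"
    and D: "countable D" "D \<noteq> {}" "D \<subseteq> S" "S \<subseteq> closure D"
    and c: "sum_dominated M N c"
    and cont: "\<And>y. y \<in> space N \<Longrightarrow> continuous_on S (\<lambda>x. c (x, y))"
  shows "sup_duality M N c"
proof (rule sup_duality_approx[OF c])
  interpret pair_prob_space M N by fact
  fix \<delta> :: real assume \<delta>: "0 < \<delta>"
  obtain F G where FG: "integrable M F" "integrable N G"
    "\<And>x y. x \<in> space M \<Longrightarrow> y \<in> space N \<Longrightarrow> \<bar>c (x, y)\<bar> \<le> F x + G y"
    using c by (auto simp: sum_dominated_def)
  define F' G' where "F' n x = max 0 (\<bar>F x\<bar> - real n)" and "G' n y = max 0 (\<bar>G y\<bar> - real n)"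
    for n :: nat and x y
  have "(\<lambda>n. integral\<^sup>L M (F' n) + integral\<^sup>L N (G' n)) \<longlonglongrightarrow> 0 + 0"
    unfolding F'_def G'_def by (intro tendsto_add integral_tail_tendsto_0 FG)
  from LIMSEQ_D[OF this \<delta>] obtain n where "\<bar>integral\<^sup>L M (F' n) + integral\<^sup>L N (G' n)\<bar> < \<delta>"
    by auto
  then have small: "integral\<^sup>L M (F' n) + integral\<^sup>L N (G' n) \<le> \<delta>" by linarith
  have F'G': "integrable M (F' n)" "integrable N (G' n)"
    unfolding F'_def G'_def using FG by (auto intro!: integrable_max)
  \<comment> \<open>Truncating at \<open>2 * real n\<close> splits as \<open>n + n\<close>: the
    excess of \<open>\<bar>F x\<bar> + \<bar>G y\<bar>\<close> over \<open>2 * n\<close> is at most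
    the sum of the separate excesses over \<open>n\<close>, so the error is again a sum of functions
    of one variable.\<close>
  define k where "k z = max (- (2 * real n)) (min (2 * real n) (c z))" for z
  have k: "k \<in> borel_measurable (M \<Otimes>\<^sub>M N)"
    unfolding k_def using sum_dominated_measurable[OF c] by measurable
  have K: "\<bar>k z\<bar> \<le> 2 * real n" for z by (auto simp: k_def)
  have "continuous_on S (\<lambda>x. k (x, y))" if "y \<in> space N" for y
    unfolding k_def using cont[OF that] by (intro continuous_intros)
  then have "sup_duality M N k"
    using K by (intro sup_duality_bounded_continuous[OF MN M S D k])
  moreover have "sum_dominated M N k" using k K by (rule sum_dominated_bounded)
  moreover have "\<bar>c (x, y) - k (x, y)\<bar> \<le> F' n x + G' n y" if "x \<in> space M" "y \<in> space N" for x y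
  proof -
    have "\<bar>c (x, y) - k (x, y)\<bar> \<le> max 0 (\<bar>c (x, y)\<bar> - 2 * real n)"
      unfolding k_def by (auto simp: max_def min_def abs_if)
    also have "\<dots> \<le> max 0 (\<bar>F x\<bar> + \<bar>G y\<bar> - 2 * real n)"
      using FG(3)[OF that] by (intro max.mono) auto
    also have "\<dots> \<le> F' n x + G' n y"
      by (auto simp: F'_def G'_def max_def)
    finally show ?thesis .
  qed
  ultimately show "\<exists>c' F G. sum_dominated M N c' \<and> sup_duality M N c' \<and>
      integrable M F \<and> integrable N G \<and> integral\<^sup>L M F + integral\<^sup>L N G \<le> \<delta> \<and>
      (\<forall>x\<in>space M. \<forall>y\<in>space N. \<bar>c (x, y) - c' (x, y)\<bar> \<le> F x + G y)"
    using F'G' small by blast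
qed

text \<open>The cost is altered only off \<open>S\<close> in the first variable. The altered set is
  null for every coupling, so primal values are kept; the alteration is upwards, so dual pairs for
  \<open>c0\<close> remain feasible for \<open>c\<close> at every point.\<close>

lemma exists_measurable_majorant:
  fixes M :: "'a::metric_space measure" and N :: "'b measure" and c :: "'a \<times> 'b \<Rightarrow> real"
  assumes MN: "pair_prob_space M N" and M: "sets M = sets borel" and sep: "separable_measure M"
    and F: "integrable M F" and G: "integrable N G"
    and dom: "\<And>x y. x \<in> space M \<Longrightarrow> y \<in> space N \<Longrightarrow> \<bar>c (x, y)\<bar> \<le> F x + G y"
    and cont: "\<And>y. y \<in> space N \<Longrightarrow> continuous_on UNIV (\<lambda>x. c (x, y))"
    and meas: "\<And>x. (\<lambda>y. c (x, y)) \<in> borel_measurable N"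
  obtains c0 S where "sum_dominated M N c0" "sup_duality M N c0"
    and "\<And>x y. x \<in> space M \<Longrightarrow> y \<in> space N \<Longrightarrow> c (x, y) \<le> c0 (x, y)"
    and "AE x in M. x \<in> S" and "\<And>x y. x \<in> S \<Longrightarrow> c0 (x, y) = c (x, y)"
proof -
  interpret pair_prob_space M N by fact
  obtain S where S: "S \<in> sets M" "separable_space (top_of_set S)" "emeasure M S = 1"
    using sep M by (auto simp: separable_measure_def)
  have AE_S: "AE x in M. x \<in> S"
    using S(1,3) by (simp add: M1.AE_in_set_eq_1 M1.emeasure_eq_measure)
  obtain D where D: "countable D" "D \<subseteq> S" "top_of_set S closure_of D = S"
    using S(2) by (auto simp: separable_space_def)
  have "S \<subseteq> closure D"
    using D(3) closure_mono[of "S \<inter> D" D] by (auto simp: closure_of_subtopology)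
  moreover have "D \<noteq> {}" using D(3) S(3) by auto
  ultimately have D': "countable D" "D \<noteq> {}" "D \<subseteq> S" "S \<subseteq> closure D" using D by auto
  \<comment> \<open>Off the separable set nothing is known about the measurability of \<open>c\<close>; the upper bound keeps
    every dual pair for \<open>c0\<close> feasible for \<open>c\<close>.\<close>
  define c0 where "c0 z = (if fst z \<in> S then c z else F (fst z) + G (snd z))" for z
  have c_abs: "\<bar>c0 (x, y)\<bar> \<le> F x + G y" if "x \<in> space M" "y \<in> space N" for x y
    using dom[OF that] by (auto simp: c0_def)
  have contS: "continuous_on S (\<lambda>x. c (x, y))" if "y \<in> space N" for y
    using cont[OF that] by (rule continuous_on_subset) simp
  note [measurable] = borel_measurable_integrable[OF F] borel_measurable_integrable[OF G]
  have SP[measurable]: "Measurable.pred (M \<Otimes>\<^sub>M N) (\<lambda>z. fst z \<in> S)"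
    using S(1) by measurable
  have "(\<lambda>z. if fst z \<in> S then (if fst z \<in> S then c z else 0) else F (fst z) + G (snd z))
      \<in> borel_measurable (M \<Otimes>\<^sub>M N)"
    using measurable_caratheodory[OF M S(1) D' contS meas] by measurable
  then have "c0 \<in> borel_measurable (M \<Otimes>\<^sub>M N)"
    unfolding c0_def by (simp cong: if_cong)
  with F G c_abs have "sum_dominated M N c0" by (auto simp: sum_dominated_def)
  moreover have "continuous_on S (\<lambda>x. c0 (x, y))" if "y \<in> space N" for y
    using contS[OF that] by (simp add: c0_def)
  then have "sup_duality M N c0"
    using MN M S(1) AE_S D' \<open>sum_dominated M N c0\<close> by (intro sup_duality_continuous[of M N S D c0])
  moreover have "c (x, y) \<le> c0 (x, y)" if "x \<in> space M" "y \<in> space N" for x y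
    using dom[OF that] by (auto simp: c0_def)
  ultimately show thesis
    using AE_S by (intro that[of c0 S]) (auto simp: c0_def)
qed

subsection \<open>Suprema and infima\<close>

lemma borel_measurable_completion_AE:
  fixes f g :: "'a \<Rightarrow> real"
  assumes f: "f \<in> borel_measurable M" and eq: "AE x in M. f x = g x"
  shows "g \<in> borel_measurable (completion M)"
proof -
  obtain N where N: "{x\<in>space M. f x \<noteq> g x} \<subseteq> N" "N \<in> null_sets M"
    using eq by (auto elim!: AE_E simp: null_sets_def)
  show ?thesis
  proof (rule measurableI)
    fix A :: "real set" assume A: "A \<in> sets borel"
    have "g -` A \<inter> space M = (f -` A \<inter> space M - N) \<union> (g -` A \<inter> space M \<inter> N)"
      using N(1) by auto
    also have "\<dots> \<in> sets (completion M)"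
    proof (rule sets.Un)
      show "f -` A \<inter> space M - N \<in> sets (completion M)"
        using measurable_sets[OF f A] N(2) by auto
      show "g -` A \<inter> space M \<inter> N \<in> sets (completion M)"
        using N(2) null_sets_completion_subset[of "g -` A \<inter> space M \<inter> N" N M]
        by (auto dest: null_sets_completionI)
    qed
    finally show "g -` A \<inter> space (completion M) \<in> sets (completion M)" by simp
  qed simp
qed

text \<open>This turns the integrals of \<open>c\<close> against completed couplings into ordinary
  integrals of the measurable majorant.\<close>

lemma integral_completion_AE:
  fixes f g :: "'a \<Rightarrow> real"
  assumes f: "f \<in> borel_measurable M" and eq: "AE x in M. f x = g x"
  shows "integral\<^sup>L (completion M) g = integral\<^sup>L M f"
proof -
  have "integral\<^sup>L (completion M) g = integral\<^sup>L (completion M) f"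
    using borel_measurable_completion_AE[OF f eq] measurable_completion[OF f] eq
    by (intro integral_cong_AE AE_completion) auto
  with integral_completion[OF f] show ?thesis by simp
qed

text \<open>The two links between \<open>c\<close> and \<open>c0\<close> serve opposite directions:
  almost sure equality gives weak duality for pairs feasible for \<open>c\<close>, and
  \<open>c \<le> c0\<close> makes the near-optimal pairs for \<open>c0\<close> feasible for
  \<open>c\<close>.\<close>

lemma ot_primal_sup_eq_dual_inf:
  assumes MN: "pair_prob_space M N"
    and c0: "sum_dominated M N c0" "sup_duality M N c0"
    and le: "\<And>x y. x \<in> space M \<Longrightarrow> y \<in> space N \<Longrightarrow> c (x, y) \<le> c0 (x, y)"
    and eq: "\<And>P. P \<in> couplings M N \<Longrightarrow> AE z in P. c0 z = c z"
  shows "ot_primal_sup M N c = ot_dual_inf M N c"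
proof -
  interpret pair_prob_space M N by fact
  define V where "V = {integral\<^sup>L M f + integral\<^sup>L N g | f g. integrable M f \<and> integrable N g \<and>
    (\<forall>x\<in>space M. \<forall>y\<in>space N. c (x, y) \<le> f x + g y)}"
  have product: "M \<Otimes>\<^sub>M N \<in> couplings M N"
    by (simp add: couplings_def prob_space_axioms M2.emeasure_pair_measure_Times
        M1.emeasure_space_1 M2.emeasure_space_1)
  have primal: "ot_primal_sup M N c = (SUP P\<in>couplings M N. integral\<^sup>L P c0)"
    unfolding ot_primal_sup_def
  proof (intro SUP_cong refl integral_completion_AE eq)
    show "c0 \<in> borel_measurable P" if "P \<in> couplings M N" for P
      using sum_dominated_measurable[OF c0(1)]
      by (simp add: measurable_cong_sets[OF couplingsD(2)[OF that] refl])
  qed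
  have weak: "integral\<^sup>L P c0 \<le> v" if P: "P \<in> couplings M N" and v: "v \<in> V" for P v
  proof -
    obtain f g where fg: "integrable M f" "integrable N g" "v = integral\<^sup>L M f + integral\<^sup>L N g"
      "\<And>x y. x \<in> space M \<Longrightarrow> y \<in> space N \<Longrightarrow> c (x, y) \<le> f x + g y"
      using v by (auto simp: V_def)
    have "AE z in P. c0 z \<le> f (fst z) + g (snd z)"
      using eq[OF P] AE_space
    proof eventually_elim
      case (elim z)
      with fg(4)[of "fst z" "snd z"] show ?case by (auto simp: couplingsD(3)[OF P])
    qed
    with P c0(1) fg show ?thesis
      by (simp add: coupling_integral_le integrable_coupling)
  qed
  define s where "s = (SUP P\<in>couplings M N. integral\<^sup>L P c0)"
  have strong: "\<exists>v\<in>V. v \<le> s' + \<epsilon>"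
    if s': "\<And>P. P \<in> couplings M N \<Longrightarrow> integral\<^sup>L P c0 \<le> s'" and \<epsilon>: "0 < \<epsilon>" for s' \<epsilon>
  proof -
    obtain f g where fg: "integrable M f" "integrable N g"
      "\<And>x y. x \<in> space M \<Longrightarrow> y \<in> space N \<Longrightarrow> c0 (x, y) \<le> f x + g y"
      "integral\<^sup>L M f + integral\<^sup>L N g \<le> s' + \<epsilon>"
      using sup_dualityE[OF c0(2) s' \<epsilon>] by blast
    have "c (x, y) \<le> f x + g y" if "x \<in> space M" "y \<in> space N" for x y
      using le[OF that] fg(3)[OF that] by simp
    with fg(1,2) have "integral\<^sup>L M f + integral\<^sup>L N g \<in> V" by (auto simp: V_def)
    with fg(4) show ?thesis by blast
  qed
  \<comment> \<open>The dominating pair shows that \<open>V\<close> is nonempty and the primal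
    values are bounded above. The product measure shows that there are couplings and that
    \<open>V\<close> is bounded below.\<close>
  obtain F G where FG: "integrable M F" "integrable N G"
    "\<And>x y. x \<in> space M \<Longrightarrow> y \<in> space N \<Longrightarrow> \<bar>c0 (x, y)\<bar> \<le> F x + G y"
    using c0(1) by (auto simp: sum_dominated_def)
  have V_mem: "integral\<^sup>L M F + integral\<^sup>L N G \<in> V"
    unfolding V_def using FG(1,2) order_trans[OF le order_trans[OF abs_ge_self FG(3)]] by blast
  have bdd: "bdd_above ((\<lambda>P. integral\<^sup>L P c0) ` couplings M N)"
    using weak[OF _ V_mem] by (rule bdd_aboveI2)
  have "s \<le> Inf V"
    unfolding s_def using V_mem product weak by (intro cSUP_least cInf_greatest) auto
  moreover have "Inf V \<le> s"
  proof (rule field_le_epsilon)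
    fix \<epsilon> :: real assume "0 < \<epsilon>"
    moreover have "integral\<^sup>L P c0 \<le> s" if "P \<in> couplings M N" for P
      unfolding s_def using that by (intro cSUP_upper bdd)
    ultimately obtain v where v: "v \<in> V" "v \<le> s + \<epsilon>" using strong by blast
    have "Inf V \<le> v"
      using v(1) weak[OF product] by (intro cInf_lower bdd_belowI[of V "integral\<^sup>L (M \<Otimes>\<^sub>M N) c0"])
    with v(2) show "Inf V \<le> s + \<epsilon>" by simp
  qed
  ultimately show ?thesis
    unfolding primal ot_dual_inf_def V_def[symmetric] s_def[symmetric] by simp
qed

lemma ot_primal_sup_eq_dual_inf_fst:
  fixes M :: "'a::metric_space measure" and N :: "'b measure" and c :: "'a \<times> 'b \<Rightarrow> real"
  assumes MN: "pair_prob_space M N" and M: "sets M = sets borel" "separable_measure M"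
    and F: "integrable M F" and G: "integrable N G"
    and dom: "\<And>x y. x \<in> space M \<Longrightarrow> y \<in> space N \<Longrightarrow> \<bar>c (x, y)\<bar> \<le> F x + G y"
    and cont: "\<And>y. y \<in> space N \<Longrightarrow> continuous_on UNIV (\<lambda>x. c (x, y))"
    and meas: "\<And>x. (\<lambda>y. c (x, y)) \<in> borel_measurable N"
  shows "ot_primal_sup M N c = ot_dual_inf M N c"
proof (rule exists_measurable_majorant[OF MN M F G dom cont meas])
  fix c0 S
  assume c0: "sum_dominated M N c0" "sup_duality M N c0"
      "\<And>x y. x \<in> space M \<Longrightarrow> y \<in> space N \<Longrightarrow> c (x, y) \<le> c0 (x, y)"
    and S: "AE x in M. x \<in> S" "\<And>x y. x \<in> S \<Longrightarrow> c0 (x, y) = c (x, y)"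
  show ?thesis
  proof (rule ot_primal_sup_eq_dual_inf[OF MN c0])
    fix P assume P: "P \<in> couplings M N"
    \<comment> \<open>The first marginal of \<open>P\<close> is \<open>M\<close>, so
      \<open>P\<close> is carried by the points whose first coordinate lies in \<open>S\<close>,
      where \<open>c0\<close> and \<open>c\<close> coincide.\<close>
    from S(1) have "AE x in distr P M fst. x \<in> S" by (subst couplingsD(4)[OF P])
    from AE_distrD[OF couplingsD(6)[OF P] this] show "AE z in P. c0 z = c z"
      by eventually_elim (use S(2) in \<open>metis prod.collapse\<close>)
  qed
qed

text \<open>The majorant is built for the swapped cost, where the separable factor comes first, and
  transported back as \<open>c1\<close>; couplings and dual pairs are exchanged accordingly.\<close>

lemma ot_primal_sup_eq_dual_inf_snd:
  fixes M :: "'a measure" and N :: "'b::metric_space measure" and c :: "'a \<times> 'b \<Rightarrow> real"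
  assumes MN: "pair_prob_space M N" and N: "sets N = sets borel" "separable_measure N"
    and F: "integrable M F" and G: "integrable N G"
    and dom: "\<And>x y. x \<in> space M \<Longrightarrow> y \<in> space N \<Longrightarrow> \<bar>c (x, y)\<bar> \<le> F x + G y"
    and cont: "\<And>x. x \<in> space M \<Longrightarrow> continuous_on UNIV (\<lambda>y. c (x, y))"
    and meas: "\<And>y. (\<lambda>x. c (x, y)) \<in> borel_measurable M"
  shows "ot_primal_sup M N c = ot_dual_inf M N c"
proof -
  interpret pair_prob_space M N by fact
  interpret swapped: pair_prob_space N M ..
  show ?thesis
  proof (rule exists_measurable_majorant[OF swapped.pair_prob_space_axioms N G F,
        where c = "\<lambda>z. c (prod.swap z)"])
    show "\<bar>c (prod.swap (y, x))\<bar> \<le> G y + F x" if "y \<in> space N" "x \<in> space M" for y x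
      using dom[OF that(2,1)] by simp
    show "continuous_on UNIV (\<lambda>y. c (prod.swap (y, x)))" if "x \<in> space M" for x
      using cont[OF that] by simp
    show "(\<lambda>x. c (prod.swap (y, x))) \<in> borel_measurable M" for y
      using meas by simp
    fix c0 S
    assume c0: "sum_dominated N M c0" "sup_duality N M c0"
        "\<And>y x. y \<in> space N \<Longrightarrow> x \<in> space M \<Longrightarrow> c (prod.swap (y, x)) \<le> c0 (y, x)"
      and S: "AE y in N. y \<in> S" "\<And>y x. y \<in> S \<Longrightarrow> c0 (y, x) = c (prod.swap (y, x))"
    define c1 where "c1 z = c0 (prod.swap z)" for z
    have swap: "prod.swap \<in> M \<Otimes>\<^sub>M N \<rightarrow>\<^sub>M N \<Otimes>\<^sub>M M" unfolding prod.swap_def by measurable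
    have c1: "c1 \<in> borel_measurable (M \<Otimes>\<^sub>M N)"
      unfolding c1_def by (rule measurable_compose[OF swap sum_dominated_measurable[OF c0(1)]])
    obtain G' F' where "integrable N G'" "integrable M F'"
      "\<And>y x. y \<in> space N \<Longrightarrow> x \<in> space M \<Longrightarrow> \<bar>c0 (y, x)\<bar> \<le> G' y + F' x"
      using c0(1) by (auto simp: sum_dominated_def)
    with c1 have "sum_dominated M N c1"
      unfolding sum_dominated_def c1_def by (auto simp: add.commute intro!: exI[of _ F'] exI[of _ G'])
    moreover have "sup_duality M N c1"
      using c0(2) by (intro sup_duality_swap[OF c1]) (simp add: c1_def)
    moreover have "c (x, y) \<le> c1 (x, y)" if "x \<in> space M" "y \<in> space N" for x y
      using c0(3)[OF that(2,1)] by (simp add: c1_def)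
    moreover have "AE z in P. c1 z = c z" if P: "P \<in> couplings M N" for P
    proof -
      from S(1) have "AE y in distr P N snd. y \<in> S" by (subst couplingsD(5)[OF P])
      from AE_distrD[OF couplingsD(7)[OF P] this] show ?thesis
        by eventually_elim (simp add: c1_def S(2) prod.swap_def)
    qed
    ultimately show ?thesis by (rule ot_primal_sup_eq_dual_inf[OF MN])
  qed
qed

section \<open>Exchange of the two problems by a change of sign\<close>

lemma ot_primal_inf_uminus: "ot_primal_inf M N c = - ot_primal_sup M N (\<lambda>z. - c z)"
  \<comment> \<open>On the reals \<open>Inf\<close> is by definition the negated \<open>Sup\<close>
    of the negated set, so this is pure rewriting, valid for every \<open>c\<close>.\<close>
  by (simp add: ot_primal_inf_def ot_primal_sup_def Inf_real_def image_image)

lemma ot_dual_sup_uminus: "ot_dual_sup M N c = - ot_dual_inf M N (\<lambda>z. - c z)"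
proof -
  let ?V = "{integral\<^sup>L M f + integral\<^sup>L N g | f g. integrable M f \<and> integrable N g \<and>
    (\<forall>x\<in>space M. \<forall>y\<in>space N. f x + g y \<le> c (x, y))}"
  let ?W = "{integral\<^sup>L M f + integral\<^sup>L N g | f g. integrable M f \<and> integrable N g \<and>
    (\<forall>x\<in>space M. \<forall>y\<in>space N. - c (x, y) \<le> f x + g y)}"
  have "?V = uminus ` ?W"
  proof (intro set_eqI iffI)
    fix v assume "v \<in> ?V"
    then obtain f g where fg: "v = integral\<^sup>L M f + integral\<^sup>L N g" "integrable M f" "integrable N g"
      "\<forall>x\<in>space M. \<forall>y\<in>space N. f x + g y \<le> c (x, y)" by blast
    have "- v = (\<integral>x. - f x \<partial>M) + (\<integral>y. - g y \<partial>N)" using fg by simp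
    moreover have "\<forall>x\<in>space M. \<forall>y\<in>space N. - c (x, y) \<le> - f x + - g y"
      using fg(4) by (simp add: algebra_simps)
    ultimately have "- v \<in> ?W"
      using fg(2,3) by (intro CollectI exI[of _ "\<lambda>x. - f x"] exI[of _ "\<lambda>y. - g y"]) simp
    then show "v \<in> uminus ` ?W" by (rule rev_image_eqI) simp
  next
    fix v assume "v \<in> uminus ` ?W"
    then obtain f g where fg: "v = - (integral\<^sup>L M f + integral\<^sup>L N g)" "integrable M f" "integrable N g"
      "\<forall>x\<in>space M. \<forall>y\<in>space N. - c (x, y) \<le> f x + g y" by blast
    have "v = (\<integral>x. - f x \<partial>M) + (\<integral>y. - g y \<partial>N)" using fg by simp
    moreover have "\<forall>x\<in>space M. \<forall>y\<in>space N. - f x + - g y \<le> c (x, y)"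
      using fg(4) by (force simp: algebra_simps)
    ultimately show "v \<in> ?V"
      using fg(2,3) by (intro CollectI exI[of _ "\<lambda>x. - f x"] exI[of _ "\<lambda>y. - g y"]) simp
  qed
  then show ?thesis by (simp add: ot_dual_sup_def ot_dual_inf_def Inf_real_def image_image)
qed

theorem theorem7:
  fixes \<mu> :: "'a::metric_space measure"
    and \<nu> :: "'b::metric_space measure"
    and c :: "'a \<times> 'b \<Rightarrow> real"
    and f1 f2 :: "'a \<Rightarrow> real"
    and g1 g2 :: "'b \<Rightarrow> real"
  assumes "prob_space \<mu>" and "sets \<mu> = sets borel"
    and "prob_space \<nu>" and "sets \<nu> = sets borel"
    and "integrable \<mu> f1" and "integrable \<mu> f2"
    and "integrable \<nu> g1" and "integrable \<nu> g2"
    and "\<And>x y. f1 x + g1 y \<le> c (x, y)"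
    and "\<And>x y. c (x, y) \<le> f2 x + g2 y"
    and "\<And>y. continuous_on UNIV (\<lambda>x. c (x, y))"
    and "\<And>x. (\<lambda>y. c (x, y)) \<in> borel_measurable borel"
  shows "(bdd_below (range c) \<and> separable_measure \<mu> \<longrightarrow>
            ot_primal_sup \<mu> \<nu> c = ot_dual_inf \<mu> \<nu> c)
       \<and> (bdd_above (range c) \<and> separable_measure \<mu> \<longrightarrow>
            ot_primal_inf \<mu> \<nu> c = ot_dual_sup \<mu> \<nu> c)
       \<and> (bounded (range c) \<and> separable_measure \<mu> \<longrightarrow>
            ot_primal_inf \<mu> \<nu> c = ot_dual_sup \<mu> \<nu> c \<and>
            ot_primal_sup \<mu> \<nu> c = ot_dual_inf \<mu> \<nu> c)
       \<and> ((\<forall>y. continuous_on UNIV (\<lambda>x. c (x, y))) \<and>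
          (\<forall>x. continuous_on UNIV (\<lambda>y. c (x, y))) \<and>
          (separable_measure \<mu> \<or> separable_measure \<nu>) \<longrightarrow>
            ot_primal_inf \<mu> \<nu> c = ot_dual_sup \<mu> \<nu> c \<and>
            ot_primal_sup \<mu> \<nu> c = ot_dual_inf \<mu> \<nu> c)"
proof -
  interpret M1: prob_space \<mu> by fact
  interpret M2: prob_space \<nu> by fact
  interpret pair_prob_space \<mu> \<nu> ..
  \<comment> \<open>Absolute values of both bounds are added so that one pair dominates
    \<open>c\<close> and \<open>- c\<close> alike.\<close>
  define F G where "F x = \<bar>f1 x\<bar> + \<bar>f2 x\<bar>" and "G y = \<bar>g1 y\<bar> + \<bar>g2 y\<bar>" for x y
  have F: "integrable \<mu> F" and G: "integrable \<nu> G"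
    unfolding F_def G_def using assms(5-8) by auto
  have dom: "\<bar>c (x, y)\<bar> \<le> F x + G y" "\<bar>- c (x, y)\<bar> \<le> F x + G y" for x y
    using assms(9)[of x y] assms(10)[of x y] by (auto simp: F_def G_def)
  have meas: "(\<lambda>y. c (x, y)) \<in> borel_measurable \<nu>" "(\<lambda>y. - c (x, y)) \<in> borel_measurable \<nu>" for x
    using assms(12)[of x] by (simp_all add: measurable_cong_sets[OF assms(4) refl])
  have fst: "ot_primal_sup \<mu> \<nu> c = ot_dual_inf \<mu> \<nu> c \<and> ot_primal_inf \<mu> \<nu> c = ot_dual_sup \<mu> \<nu> c"
    if "separable_measure \<mu>"
    unfolding ot_primal_inf_uminus[of _ _ c] ot_dual_sup_uminus[of _ _ c]
    using ot_primal_sup_eq_dual_inf_fst[OF pair_prob_space_axioms assms(2) that F G dom(1) assms(11) meas(1)]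
      ot_primal_sup_eq_dual_inf_fst[OF pair_prob_space_axioms assms(2) that F G dom(2)
        continuous_on_minus[OF assms(11)] meas(2)]
    by simp
  have snd: "ot_primal_sup \<mu> \<nu> c = ot_dual_inf \<mu> \<nu> c \<and> ot_primal_inf \<mu> \<nu> c = ot_dual_sup \<mu> \<nu> c"
    if sep: "separable_measure \<nu>" and cont: "\<And>x. continuous_on UNIV (\<lambda>y. c (x, y))"
  proof -
    \<comment> \<open>With the factors exchanged, measurability is required of the sections in
      \<open>x\<close>; there it comes from continuity.\<close>
    have meas': "(\<lambda>x. c (x, y)) \<in> borel_measurable \<mu>" "(\<lambda>x. - c (x, y)) \<in> borel_measurable \<mu>" for y
      using borel_measurable_continuous_onI[OF assms(11)[of y]]
      by (simp_all add: measurable_cong_sets[OF assms(2) refl])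
    show ?thesis
      unfolding ot_primal_inf_uminus[of _ _ c] ot_dual_sup_uminus[of _ _ c]
      using ot_primal_sup_eq_dual_inf_snd[OF pair_prob_space_axioms assms(4) sep F G dom(1) cont meas'(1)]
        ot_primal_sup_eq_dual_inf_snd[OF pair_prob_space_axioms assms(4) sep F G dom(2)
          continuous_on_minus[OF cont] meas'(2)]
      by simp
  qed
  \<comment> \<open>The claims about separable \<mu> come from \<open>fst\<close>; for separable
    \<nu>, continuity in \<open>y\<close> makes \<open>snd\<close> applicable.\<close>
  show ?thesis using fst snd by blast
qed

end
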